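(* Let $(\mathcal A,\varphi,\varphi^2)$ be a second order non-commutative probability space and let $a,b\in\mathcal A$ be two second order free semicircular variables. Then for all $n,m\ge1$ the second order free cumulants of their product are $$\kappa_{n,m}^{ab}=\begin{cases} n\,(\kappa_2^a\kappa_2^b)^n & \text{if } n=m,\\ 0&\text{otherwise.}\end{cases}$$
   Context: Permutations are composed right to left; $\#(\pi)$ is the number of cycles of $\pi$; a permutation is also regarded as a partition whose blocks are its cycles; $\vee$ is the join in the lattice of all set partitions. Second order non-commutative probability space: a triple $(\mathcal A,\varphi,\varphi^2)$ with $\mathcal A$ a unital algebra over $\mathbb C$, $\varphi:\mathcal A\to\mathbb C$ a linear functional with $\varphi(1)=1$, and $\varphi^2:\mathcal A\times\mathcal A\to\mathbb C$ bilinear, tracial in each argument, with $\varphi^2(x,1)=0=\varphi^2(1,x)$ for all $x\in\mathcal A$. $NC(p)$: non-crossing partitions of $\{1,\dots,p\}$, each identified with the permutation whose cycles are the blocks in increasing order (similarly for other linearly ordered sets). Put $\gamma_{p,q}=(1,\dots,p)(p+1,\dots,p+q)\in S_{p+q}$. $S_{NC}(p,q)$: all $\pi\in S_{p+q}$ such that $\pi\vee\gamma_{p,q}$ is the one-block partition and $\#(\pi)+\#(\pi^{-1}\gamma_{p,q})=p+q$. $S'_{NC}(p,q)$: all pairs $(\mathcal U,\pi)$ with $\pi=\pi_1\times\pi_2$, $\pi_1\in NC(\{1,\dots,p\})$, $\pi_2\in NC(\{p+1,\dots,p+q\})$, and $\mathcal U$ the partition whose blocks are the cycles of $\pi$ except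 that exactly one cycle $A$ of $\pi_1$ and one cycle $B$ of $\pi_2$ are merged into one block. Cumulants: the free cumulants $\kappa_n$ are the multilinear functionals defined recursively by $\varphi(a_1\cdots a_n)=\sum_{\pi\in NC(n)}\prod_{V\in\pi}\kappa_{|V|}(a_V)$, and the second order free cumulants $\kappa_{p,q}$ are defined recursively by $$\varphi^2(a_1\cdots a_p,a_{p+1}\cdots a_{p+q})=\sum_{\pi\in S_{NC}(p,q)}\prod_{V\in\pi}\kappa_{|V|}(a_V)+\sum_{(\mathcal U,\pi)\in S'_{NC}(p,q)}\kappa_{|A|,|B|}(a_A,a_B)\prod_{V\in\pi\setminus\{A,B\}}\kappa_{|V|}(a_V),$$ where $a_V$ lists the $a_i$, $i\in V$, in the order of the cycle $V$ (increasing order for blocks of non-crossing partitions). Write $\kappa_n^x=\kappa_n(x,\dots,x)$ and $\kappa_{n,m}^x=\kappa_{n,m}(x,\dots,x)$. Elements $a,b$ are second order free iff all mixed cumulants vanish: $\kappa_n(a_1,\dots,a_n)=0$ ($n\ge2$) and $\kappa_{n,m}(a_1,\dots,a_{n+m})=0$ ($n,m\ge1$) whenever the $a_i\in\{a,b\}$ are not all equal. A (second order) semicircular variable $x$ is one with $\kappa_n^x=0$ for all $n\ne2$ and $\kappa_{n,m}^x=0$ for all $(n,m)\neq(2,2)$ (the values $\kappa_2^x,\kappa_{2,2}^x$ being arbitrary). *)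

theory Defs
  imports Complex_Main "HOL-Library.Disjoint_Sets" "HOL-Combinatorics.Cycles" "HOL-Combinatorics.Orbits"
begin

section \<open>Second order non-commutative probability spaces\<close>

text \<open>The class \<open>ring_1\<close> excludes the zero ring, which \<open>\<phi> 1 = 1\<close> excludes anyway.
  Note that only \<open>\<phi>2\<close> is assumed to be tracial, not \<open>\<phi>\<close>.\<close>

locale second_order_ncps = vector_space scale
  for scale :: "complex \<Rightarrow> 'a::ring_1 \<Rightarrow> 'a" +
  fixes \<phi> :: "'a \<Rightarrow> complex" and \<phi>2 :: "'a \<Rightarrow> 'a \<Rightarrow> complex"
  assumes scale_mult_left: "scale c x * y = scale c (x * y)"
    and scale_mult_right: "x * scale c y = scale c (x * y)"
    and linear_\<phi>: "Vector_Spaces.linear scale (*) \<phi>"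
    and \<phi>_one: "\<phi> 1 = 1"
    and linear_\<phi>2_left: "Vector_Spaces.linear scale (*) (\<lambda>x. \<phi>2 x y)"
    and linear_\<phi>2_right: "Vector_Spaces.linear scale (*) (\<lambda>y. \<phi>2 x y)"
    and tracial_\<phi>2_left: "\<phi>2 (x * y) z = \<phi>2 (y * x) z"
    and tracial_\<phi>2_right: "\<phi>2 z (x * y) = \<phi>2 z (y * x)"
    and \<phi>2_one_left: "\<phi>2 1 x = 0"
    and \<phi>2_one_right: "\<phi>2 x 1 = 0"

section \<open>Non-crossing partitions and annular permutations\<close>

definition crossing :: "nat set \<Rightarrow> nat set \<Rightarrow> bool" where
  "crossing A B \<longleftrightarrow> (\<exists>a\<in>A. \<exists>b\<in>B. \<exists>c\<in>A. \<exists>d\<in>B. a < b \<and> b < c \<and> c < d)"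

definition NC :: "nat set \<Rightarrow> nat set set set" where
  "NC S = {P. partition_on S P \<and> (\<forall>A\<in>P. \<forall>B\<in>P. A \<noteq> B \<longrightarrow> \<not> crossing A B)}"

definition cycle_partition :: "nat set \<Rightarrow> (nat \<Rightarrow> nat) \<Rightarrow> nat set set" where
  "cycle_partition S \<pi> = orbit \<pi> ` S"

definition num_cycles :: "nat set \<Rightarrow> (nat \<Rightarrow> nat) \<Rightarrow> nat" where
  "num_cycles S \<pi> = card (cycle_partition S \<pi>)"

definition is_partition_join :: "nat set \<Rightarrow> nat set set \<Rightarrow> nat set set \<Rightarrow> nat set set \<Rightarrow> bool" where
  "is_partition_join S P Q R \<longleftrightarrow> refines S P R \<and> refines S Q R \<and>
     (\<forall>R'. refines S P R' \<and> refines S Q R' \<longrightarrow> refines S R R')"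

definition annular_cycle :: "nat \<Rightarrow> nat \<Rightarrow> nat \<Rightarrow> nat" where
  "annular_cycle p q = cycle_of_list [1..<p + 1] \<circ> cycle_of_list [p + 1..<p + q + 1]"

definition S_NC :: "nat \<Rightarrow> nat \<Rightarrow> (nat \<Rightarrow> nat) set" where
  "S_NC p q = {\<pi>. \<pi> permutes {1..p + q} \<and>
     is_partition_join {1..p + q} (cycle_partition {1..p + q} \<pi>)
       (cycle_partition {1..p + q} (annular_cycle p q)) {{1..p + q}} \<and>
     num_cycles {1..p + q} \<pi> + num_cycles {1..p + q} (inv \<pi> \<circ> annular_cycle p q) = p + q}"

text \<open>The permutation \<open>\<pi> = \<pi>\<^sub>1 \<times> \<pi>\<^sub>2\<close> is represented by its set \<open>P\<close> of cycles.\<close>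

definition S_NC' :: "nat \<Rightarrow> nat \<Rightarrow> (nat set set \<times> nat set set) set" where
  "S_NC' p q = {(U, P). \<exists>P1 \<in> NC {1..p}. \<exists>P2 \<in> NC {p + 1..p + q}. \<exists>A \<in> P1. \<exists>B \<in> P2.
     P = P1 \<union> P2 \<and> U = insert (A \<union> B) (P - {A, B})}"

text \<open>For \<open>(U, P) \<in> S_NC' p q\<close>, the cycles of \<open>P\<close> that are not blocks of \<open>U\<close> are exactly the two
  merged ones, \<open>A\<close> on the first circle and \<open>B\<close> on the second.\<close>

definition merged_cycle :: "nat set \<Rightarrow> nat set set \<Rightarrow> nat set set \<Rightarrow> nat set" where
  "merged_cycle S U P = (THE V. V \<in> P - U \<and> V \<subseteq> S)"

section \<open>Free cumulants of first and second order\<close>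

definition entries :: "'a list \<Rightarrow> nat list \<Rightarrow> 'a list" where
  "entries xs is = map (\<lambda>i. xs ! (i - 1)) is"

definition increasing_entries :: "'a list \<Rightarrow> nat set \<Rightarrow> 'a list" where
  "increasing_entries xs V = entries xs (sorted_list_of_set V)"

text \<open>The order of a cycle \<open>V\<close> of \<open>\<pi>\<close> is only a cyclic one; we list \<open>V\<close> starting from its least
  element. (If \<open>\<phi>\<close> is tracial, its cumulants are invariant under cyclic rotation and the choice
  does not matter.)\<close>

definition cycle_entries :: "'a list \<Rightarrow> (nat \<Rightarrow> nat) \<Rightarrow> nat set \<Rightarrow> 'a list" where
  "cycle_entries xs \<pi> V = entries xs (support \<pi> (Min V))"

lemma length_increasing_entries [simp]: "length (increasing_entries xs V) = card V"
  by (simp add: increasing_entries_def entries_def)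

lemma increasing_entries_interval:
  "increasing_entries xs {a + 1..a + n} = map (\<lambda>i. xs ! (a + i)) [0..<n]"
  by (rule nth_equalityI)
    (simp_all add: increasing_entries_def entries_def del: upt_Suc
      flip: atLeastLessThanSuc_atLeastAtMost)

lemma finite_NC: "finite S \<Longrightarrow> finite (NC S)"
  by (rule finite_subset[of _ "Pow (Pow S)"]) (auto simp: NC_def partition_on_def)

lemma NC_block_subset: "P \<in> NC S \<Longrightarrow> V \<in> P \<Longrightarrow> V \<subseteq> S"
  by (auto simp: NC_def partition_on_def)

lemma NC_block_nonempty: "P \<in> NC S \<Longrightarrow> V \<in> P \<Longrightarrow> V \<noteq> {}"
  by (auto simp: NC_def partition_on_def)

lemma NC_top_block:
  assumes "P \<in> NC S" "S \<in> P" shows "P = {S}"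
proof -
  have "V = S" if "V \<in> P" for V
    using assms that NC_block_subset[OF assms(1) that] NC_block_nonempty[OF assms(1) that]
    unfolding NC_def partition_on_def disjoint_def by blast
  then show ?thesis using assms(2) by blast
qed

lemma NC_block_card_less:
  assumes "P \<in> NC S - {{S}}" "V \<in> P" "finite S" shows "card V < card S"
  by (rule psubset_card_mono)
    (use assms NC_block_subset[of P S V] NC_top_block[of P S] in auto)

lemma NC_top: "S \<noteq> {} \<Longrightarrow> {S} \<in> NC S"
  by (simp add: NC_def partition_on_def)

text \<open>The free cumulant \<open>\<kappa>\<^sub>n(a\<^sub>1,\<dots>,a\<^sub>n)\<close> is \<open>free_cumulant \<phi> [a\<^sub>1,\<dots>,a\<^sub>n]\<close>: the moment-cumulant
  formula is solved for the term of the one-block partition.\<close>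

function free_cumulant :: "('a::ring_1 \<Rightarrow> complex) \<Rightarrow> 'a list \<Rightarrow> complex" where
  "free_cumulant \<phi> xs = \<phi> (prod_list xs) -
     (\<Sum>P \<in> NC {1..length xs} - {{{1..length xs}}}.
        \<Prod>V\<in>P. free_cumulant \<phi> (increasing_entries xs V))"
  by pat_completeness auto
termination
  by (relation "measure (\<lambda>(\<phi>, xs). length xs)")
    (use NC_block_card_less in force)+

declare free_cumulant.simps [simp del]

theorem moment_cumulant:
  assumes "xs \<noteq> []"
  shows "\<phi> (prod_list xs) =
    (\<Sum>P \<in> NC {1..length xs}. \<Prod>V\<in>P. free_cumulant \<phi> (increasing_entries xs V))"
proof -
  let ?S = "{1..length xs}"
  have "increasing_entries xs ?S = xs"
    using increasing_entries_interval[of xs 0 "length xs"] by (simp add: map_nth)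
  moreover have "{?S} \<in> NC ?S" using assms by (intro NC_top) (simp add: Suc_le_eq)
  ultimately show ?thesis
    by (subst sum.remove[of _ "{?S}"]) (auto simp: finite_NC free_cumulant.simps[of \<phi> xs])
qed

lemma S_NC'_memE:
  assumes "(U, P) \<in> S_NC' p q"
  obtains P1 P2 A B where "P1 \<in> NC {1..p}" "P2 \<in> NC {p + 1..p + q}" "A \<in> P1" "B \<in> P2"
    "P = P1 \<union> P2" "U = insert (A \<union> B) (P - {A, B})"
    "merged_cycle {1..p} U P = A" "merged_cycle {p + 1..p + q} U P = B"
proof -
  from assms obtain P1 P2 A B where *: "P1 \<in> NC {1..p}" "P2 \<in> NC {p + 1..p + q}"
    "A \<in> P1" "B \<in> P2" "P = P1 \<union> P2" "U = insert (A \<union> B) (P - {A, B})"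
    by (auto simp: S_NC'_def)
  have A: "A \<subseteq> {1..p}" "A \<noteq> {}" and B: "B \<subseteq> {p + 1..p + q}" "B \<noteq> {}"
    using * NC_block_subset NC_block_nonempty by blast+
  have disj: "{1..p} \<inter> {p + 1..p + q} = {}" by auto
  have "A \<union> B \<noteq> A" "A \<union> B \<noteq> B" using A B disj by blast+
  then have PU: "P - U = {A, B}" using * by auto
  have "merged_cycle {1..p} U P = A" "merged_cycle {p + 1..p + q} U P = B"
    unfolding merged_cycle_def PU by (rule the_equality; use A B disj in blast)+
  with * show ?thesis using that by blast
qed

lemma S_NC'_card_less:
  assumes "(U, P) \<in> S_NC' p q - {({{1..p + q}}, {{1..p}, {p + 1..p + q}})}"
  shows "card (merged_cycle {1..p} U P) + card (merged_cycle {p + 1..p + q} U P) < p + q"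
proof -
  from assms have "(U, P) \<in> S_NC' p q" by blast
  then obtain P1 P2 A B where *: "P1 \<in> NC {1..p}" "P2 \<in> NC {p + 1..p + q}" "A \<in> P1" "B \<in> P2"
    "P = P1 \<union> P2" "U = insert (A \<union> B) (P - {A, B})"
    "merged_cycle {1..p} U P = A" "merged_cycle {p + 1..p + q} U P = B"
    by (rule S_NC'_memE)
  have sub: "A \<subseteq> {1..p}" "B \<subseteq> {p + 1..p + q}" using * NC_block_subset by blast+
  have le: "card A \<le> p" "card B \<le> q" using card_mono[OF _ sub(1)] card_mono[OF _ sub(2)] by auto
  have "\<not> (card A = p \<and> card B = q)"
  proof
    assume "card A = p \<and> card B = q"
    then have AB: "A = {1..p}" "B = {p + 1..p + q}"
      using card_subset_eq[OF _ sub(1)] card_subset_eq[OF _ sub(2)] by auto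
    then have P: "P1 = {{1..p}}" "P2 = {{p + 1..p + q}}" using * NC_top_block by blast+
    have "{1..p} \<union> {p + 1..p + q} = {1..p + q}" by auto
    then have "P = {{1..p}, {p + 1..p + q}}" "U = {{1..p + q}}" using P AB * by auto
    then show False using assms by blast
  qed
  then show ?thesis using le unfolding *(7,8) by linarith
qed

text \<open>The second order free cumulant \<open>\<kappa>\<^sub>p\<^sub>,\<^sub>q(a\<^sub>1,\<dots>,a\<^sub>p\<^sub>+\<^sub>q)\<close> is
  \<open>second_order_cumulant \<phi> \<phi>2 [a\<^sub>1,\<dots>,a\<^sub>p] [a\<^sub>p\<^sub>+\<^sub>1,\<dots>,a\<^sub>p\<^sub>+\<^sub>q]\<close>: the second order moment-cumulant formula
  is solved for the term in which the two full circles are merged.\<close>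

function second_order_cumulant ::
  "('a::ring_1 \<Rightarrow> complex) \<Rightarrow> ('a \<Rightarrow> 'a \<Rightarrow> complex) \<Rightarrow> 'a list \<Rightarrow> 'a list \<Rightarrow> complex" where
  "second_order_cumulant \<phi> \<phi>2 xs ys = (let p = length xs; q = length ys in
     \<phi>2 (prod_list xs) (prod_list ys)
     - (\<Sum>\<pi> \<in> S_NC p q. \<Prod>V \<in> cycle_partition {1..p + q} \<pi>.
          free_cumulant \<phi> (cycle_entries (xs @ ys) \<pi> V))
     - (\<Sum>(U, P) \<in> S_NC' p q - {({{1..p + q}}, {{1..p}, {p + 1..p + q}})}.
          let A = merged_cycle {1..p} U P; B = merged_cycle {p + 1..p + q} U P in
          second_order_cumulant \<phi> \<phi>2 (increasing_entries (xs @ ys) A) (increasing_entries (xs @ ys) B)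
          * (\<Prod>V \<in> P - {A, B}. free_cumulant \<phi> (increasing_entries (xs @ ys) V))))"
  by pat_completeness auto
termination
  by (relation "measure (\<lambda>(\<phi>, \<phi>2, xs, ys). length xs + length ys)")
    (use S_NC'_card_less in force)+

declare second_order_cumulant.simps [simp del]

lemma finite_S_NC': "finite (S_NC' p q)"
proof (rule finite_subset)
  show "S_NC' p q \<subseteq> Pow (Pow {1..p + q}) \<times> Pow (Pow {1..p + q})"
  proof clarify
    fix U P assume "(U, P) \<in> S_NC' p q"
    then obtain P1 P2 A B where *: "P1 \<in> NC {1..p}" "P2 \<in> NC {p + 1..p + q}" "A \<in> P1" "B \<in> P2"
      "P = P1 \<union> P2" "U = insert (A \<union> B) (P - {A, B})"
      by (rule S_NC'_memE)
    have "V \<subseteq> {1..p + q}" if "V \<in> P" for V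
      using that NC_block_subset[OF *(1), of V] NC_block_subset[OF *(2), of V] *(5)
      by fastforce
    then show "U \<in> Pow (Pow {1..p + q}) \<and> P \<in> Pow (Pow {1..p + q})"
      using * by auto
  qed
qed simp

theorem second_order_moment_cumulant:
  fixes \<phi> :: "'a::ring_1 \<Rightarrow> complex"
  assumes "xs \<noteq> []" "ys \<noteq> []"
  defines "p \<equiv> length xs" and "q \<equiv> length ys"
  shows "\<phi>2 (prod_list xs) (prod_list ys) =
    (\<Sum>\<pi> \<in> S_NC p q. \<Prod>V \<in> cycle_partition {1..p + q} \<pi>.
       free_cumulant \<phi> (cycle_entries (xs @ ys) \<pi> V))
    + (\<Sum>(U, P) \<in> S_NC' p q.
         let A = merged_cycle {1..p} U P; B = merged_cycle {p + 1..p + q} U P in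
         second_order_cumulant \<phi> \<phi>2 (increasing_entries (xs @ ys) A) (increasing_entries (xs @ ys) B)
         * (\<Prod>V \<in> P - {A, B}. free_cumulant \<phi> (increasing_entries (xs @ ys) V)))"
proof -
  let ?U = "{{1..p + q}}" and ?P = "{{1..p}, {p + 1..p + q}}"
  have ne: "{1..p} \<noteq> {}" "{p + 1..p + q} \<noteq> {}"
    using assms by (auto simp: Suc_le_eq)
  have un: "{1..p} \<union> {p + 1..p + q} = {1..p + q}" by auto
  have mem: "(?U, ?P) \<in> S_NC' p q"
    unfolding S_NC'_def mem_Collect_eq case_prod_conv
    by (intro bexI[of _ "{{1..p}}"] bexI[of _ "{{p + 1..p + q}}"]
        bexI[of _ "{1..p}"] bexI[of _ "{p + 1..p + q}"] conjI NC_top ne)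
      (use un in auto)
  then obtain P1 P2 A B where *: "P1 \<in> NC {1..p}" "P2 \<in> NC {p + 1..p + q}" "A \<in> P1" "B \<in> P2"
    "?P = P1 \<union> P2" "merged_cycle {1..p} ?U ?P = A" "merged_cycle {p + 1..p + q} ?U ?P = B"
    by (rule S_NC'_memE)
  have A: "A \<subseteq> {1..p}" "A \<noteq> {}" "A \<in> ?P"
    using NC_block_subset[OF *(1,3)] NC_block_nonempty[OF *(1,3)] *(3) unfolding *(5) by simp_all
  have B: "B \<subseteq> {p + 1..p + q}" "B \<noteq> {}" "B \<in> ?P"
    using NC_block_subset[OF *(2,4)] NC_block_nonempty[OF *(2,4)] *(4) unfolding *(5) by simp_all
  have disj: "{1..p} \<inter> {p + 1..p + q} = {}" by auto
  have "A \<noteq> {p + 1..p + q}" "B \<noteq> {1..p}" using A(1,2) B(1,2) disj by blast+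
  then have AB: "A = {1..p}" "B = {p + 1..p + q}" using A(3) B(3) by simp_all
  have "increasing_entries (xs @ ys) {1..p} = xs"
    using increasing_entries_interval[of "xs @ ys" 0 p]
    by (auto simp: p_def nth_append intro!: nth_equalityI)
  moreover have "increasing_entries (xs @ ys) {p + 1..p + q} = ys"
    unfolding increasing_entries_interval
    by (rule nth_equalityI) (simp_all add: p_def q_def nth_append)
  ultimately show ?thesis
    using * AB
    by (subst sum.remove[OF finite_S_NC' mem])
      (simp add: second_order_cumulant.simps[of \<phi> \<phi>2 xs ys] Let_def flip: p_def q_def)
qed

abbreviation free_cumulant_of :: "('a::ring_1 \<Rightarrow> complex) \<Rightarrow> 'a \<Rightarrow> nat \<Rightarrow> complex" where
  "free_cumulant_of \<phi> x n \<equiv> free_cumulant \<phi> (replicate n x)"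

abbreviation second_order_cumulant_of ::
  "('a::ring_1 \<Rightarrow> complex) \<Rightarrow> ('a \<Rightarrow> 'a \<Rightarrow> complex) \<Rightarrow> 'a \<Rightarrow> nat \<Rightarrow> nat \<Rightarrow> complex" where
  "second_order_cumulant_of \<phi> \<phi>2 x n m \<equiv>
     second_order_cumulant \<phi> \<phi>2 (replicate n x) (replicate m x)"

section \<open>Second order freeness and semicircular variables\<close>

text \<open>A choice of arguments from \<open>a\<close> and \<open>b\<close> is given by a list of labels, and it is mixed if
  both labels occur. Being mixed is a property of the labels and not of the elements: otherwise
  every \<open>a\<close> would be free from itself.\<close>

definition choose_args :: "'a \<Rightarrow> 'a \<Rightarrow> bool list \<Rightarrow> 'a list" where
  "choose_args a b cs = map (\<lambda>c. if c then a else b) cs"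

definition mixed :: "bool list \<Rightarrow> bool" where
  "mixed cs \<longleftrightarrow> True \<in> set cs \<and> False \<in> set cs"

definition second_order_free ::
  "('a::ring_1 \<Rightarrow> complex) \<Rightarrow> ('a \<Rightarrow> 'a \<Rightarrow> complex) \<Rightarrow> 'a \<Rightarrow> 'a \<Rightarrow> bool" where
  "second_order_free \<phi> \<phi>2 a b \<longleftrightarrow>
     (\<forall>cs. length cs \<ge> 2 \<and> mixed cs \<longrightarrow> free_cumulant \<phi> (choose_args a b cs) = 0) \<and>
     (\<forall>cs ds. length cs \<ge> 1 \<and> length ds \<ge> 1 \<and> mixed (cs @ ds) \<longrightarrow>
        second_order_cumulant \<phi> \<phi>2 (choose_args a b cs) (choose_args a b ds) = 0)"

definition second_order_semicircular ::
  "('a::ring_1 \<Rightarrow> complex) \<Rightarrow> ('a \<Rightarrow> 'a \<Rightarrow> complex) \<Rightarrow> 'a \<Rightarrow> bool" where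
  "second_order_semicircular \<phi> \<phi>2 x \<longleftrightarrow>
     (\<forall>n\<ge>1. n \<noteq> 2 \<longrightarrow> free_cumulant_of \<phi> x n = 0) \<and>
     (\<forall>n\<ge>1. \<forall>m\<ge>1. (n, m) \<noteq> (2, 2) \<longrightarrow> second_order_cumulant_of \<phi> \<phi>2 x n m = 0)"

end

theory Submission
  imports Defs
begin

text \<open>In a non-crossing pairing of the alternating word \<open>a b a b \<dots>\<close> some pair is adjacent and
  hence mixed. So all moments \<open>\<phi> ((a b)\<^sup>n)\<close> and all first order cumulants of \<open>a b\<close> vanish, and
  \<open>\<kappa>\<^sub>n\<^sub>,\<^sub>m\<close> of \<open>a b\<close> equals \<open>\<phi>2 ((a b)\<^sup>n) ((a b)\<^sup>m)\<close>. Expanding the latter in cumulants of \<open>a\<close> and \<open>b\<close>,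
  the same observation kills the terms from \<open>S_NC'\<close>. A surviving \<open>\<pi> \<in> S_NC\<close> is a parity preserving
  pairing; then \<open>\<pi>\<gamma>\<close> reverses parity, and counting cycles shows that it is a pairing too, that is,
  \<open>\<pi>\<gamma>\<pi> = \<gamma>\<inverse>\<close>. By connectedness \<open>\<pi>\<close> swaps the two circles, so \<open>n = m\<close> and \<open>\<pi>\<close> is one of the \<open>n\<close>
  orientation reversing bijections between them that preserve parity.\<close>

section \<open>Annular permutations\<close>

lemma orbit_involution: "f (f x) = x \<Longrightarrow> orbit f x = {x, f x}"
proof
  assume f: "f (f x) = x"
  show "orbit f x \<subseteq> {x, f x}"
  proof
    fix y assume "y \<in> orbit f x"
    then show "y \<in> {x, f x}" by induct (auto simp: f)
  qed
  show "{x, f x} \<subseteq> orbit f x"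
    using orbit.base[of f x] orbit.step[of "f x" f x] by (simp add: f)
qed

lemma orbit_card_two:
  assumes "permutation f" "card (orbit f x) = 2"
  shows "f x \<noteq> x" "f (f x) = x"
proof -
  show ne: "f x \<noteq> x"
    using assms(2) orbit_eq_singleton_iff[of f x] by auto
  have self: "x \<in> orbit f x" by (rule permutation_self_in_orbit[OF assms(1)])
  have fx: "f x \<in> orbit f x" "f (f x) \<in> orbit f x" by (auto intro: orbit.intros)
  have "finite (orbit f x)" using self by (rule finite_orbit)
  then have "orbit f x = {x, f x}"
    using card_seteq[of "orbit f x" "{x, f x}"] self fx ne assms(2) by auto
  moreover have "f (f x) \<noteq> f x"
    using ne permutation_bijective[OF assms(1)] by (metis bij_pointE)
  ultimately show "f (f x) = x" using fx by auto
qed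

lemma partition_on_cycle_partition:
  assumes "f permutes S" "finite S"
  shows "partition_on S (cycle_partition S f)"
proof -
  have perm: "permutation f" using assms permutation_permutes by blast
  have "x \<in> orbit f x" for x by (rule permutation_self_in_orbit[OF perm])
  moreover have "orbit f x \<subseteq> S" if "x \<in> S" for x by (rule permutes_orbit_subset[OF assms(1) that])
  moreover have "orbit f x = orbit f y" if "z \<in> orbit f x" "z \<in> orbit f y" for x y z
    using that orbit_cyclic_eq3[OF cyclic_on_orbit'[OF perm]] by metis
  ultimately show ?thesis
    unfolding partition_on_def cycle_partition_def disjoint_def
    using orbit_nonempty[of f] by (intro conjI) (blast | metis (no_types, lifting) disjoint_iff imageE)+
qed

lemma finite_cycle_partition: "finite S \<Longrightarrow> finite (cycle_partition S f)"
  by (simp add: cycle_partition_def)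

lemma sum_card_cycle_partition:
  assumes "f permutes S" "finite S"
  shows "(\<Sum>V\<in>cycle_partition S f. card V) = card S"
  using product_partition[OF partition_on_cycle_partition[OF assms]]
    partition_onD1[OF partition_on_cycle_partition[OF assms]] assms(2)
  by (metis Sup_upper finite_subset)

section \<open>The two-circle permutation \<open>annular_cycle\<close>\<close>

text \<open>Applying a list cycle to its own list rotates that list; comparing entry
  \<open>i\<close> of both sides gives the formula. The zero-based offset \<open>i\<close> turns the
  wrap-around into a plain \<open>mod\<close>.\<close>

lemma cycle_of_list_interval:
  assumes "i < n"
  shows "cycle_of_list [k + 1..<k + n + 1] (k + 1 + i) = k + 1 + Suc i mod n"
proof -
  let ?cs = "[k + 1..<k + n + 1]"
  have "map (cycle_of_list ?cs ^^ Suc 0) ?cs ! i = rotate (Suc 0) ?cs ! i"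
    by (subst cyclic_rotation) simp_all
  then show ?thesis
    using assms by (simp add: nth_rotate del: upt_Suc rotate_Suc)
qed

lemma annular_cycle_left:
  assumes "i \<in> {1..p}"
  shows "annular_cycle p q i = 1 + i mod p"
proof -
  \<comment> \<open>The right factor of the composition acts first and fixes the first
    circle.\<close>
  have "cycle_of_list [p + 1..<p + q + 1] i = i"
    using assms by (intro id_outside_supp) auto
  moreover have "i - 1 < p" using assms by auto
  ultimately show ?thesis
    using assms cycle_of_list_interval[of "i - 1" p 0] by (simp add: annular_cycle_def del: upt_Suc)
qed

lemma annular_cycle_right:
  assumes "j \<in> {1..q}"
  shows "annular_cycle p q (p + j) = p + (1 + j mod q)"
proof -
  have "cycle_of_list [1..<p + 1] (p + (1 + j mod q)) = p + (1 + j mod q)"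
    by (intro id_outside_supp) auto
  moreover have "j - 1 < q" using assms by auto
  ultimately show ?thesis
    using assms cycle_of_list_interval[of "j - 1" q p] by (simp add: annular_cycle_def del: upt_Suc)
qed

lemma right_circleE:
  fixes x p q :: nat
  assumes "x \<in> {p + 1..p + q}"
  obtains j where "x = p + j" "j \<in> {1..q}"
proof
  show "x = p + (x - p)" "x - p \<in> {1..q}" using assms by auto
qed

lemma annular_cycle_permutes: "annular_cycle p q permutes {1..p + q}"
  unfolding annular_cycle_def
  by (intro permutes_compose; rule permutes_subset[OF cycle_permutes]) auto

text \<open>The wrap-around steps change parity as well: they lead from \<open>p\<close> to
  \<open>1\<close> and from \<open>p + q\<close> to \<open>p + 1\<close>, and both lengths are
  even.\<close>

lemma annular_cycle_parity:
  assumes "even p" "even q" "i \<in> {1..p + q}"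
  shows "odd (annular_cycle p q i) \<longleftrightarrow> even i"
proof (cases "i \<le> p")
  case True
  then show ?thesis
    using assms by (simp add: annular_cycle_left dvd_mod_iff)
next
  case False
  then have "i \<in> {p + 1..p + q}" using assms(3) by auto
  then obtain j where "i = p + j" "j \<in> {1..q}" by (rule right_circleE)
  then show ?thesis
    using assms annular_cycle_right[of j q p]
    by (simp add: dvd_mod_iff)
qed

text \<open>Steps upward from \<open>i\<close> reach \<open>p\<close>, the wrap-around gives
  \<open>1\<close>, and from there every point of the circle is reached. With its analogue for the
  second circle, this spreads a property of one point over a whole circle.\<close>

lemma annular_cycle_invariant_left:
  assumes closed: "\<And>i. i \<in> X \<Longrightarrow> annular_cycle p q i \<in> X" and "i \<in> X" "i \<in> {1..p}"
  shows "{1..p} \<subseteq> X"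
proof -
  have up: "i + k \<in> X" if "i + k \<le> p" "i \<in> X" "i \<ge> 1" for i k
    using that
  proof (induction k)
    case (Suc k)
    then show ?case using closed[of "i + k"] annular_cycle_left[of "i + k" p q] by simp
  qed simp
  have "p \<in> X" using up[of i "p - i"] assms(2,3) by simp
  then have "1 \<in> X" using closed[of p] annular_cycle_left[of p p q] assms(3) by simp
  then show ?thesis using up[of 1] by (metis One_nat_def atLeastAtMost_iff le_add_diff_inverse order_refl subsetI)
qed

lemma annular_cycle_invariant_right:
  assumes closed: "\<And>i. i \<in> X \<Longrightarrow> annular_cycle p q i \<in> X" and "j \<in> X" "j \<in> {p + 1..p + q}"
  shows "{p + 1..p + q} \<subseteq> X"
proof -
  have up: "p + (i + k) \<in> X" if "i + k \<le> q" "p + i \<in> X" "i \<ge> 1" for i k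
    using that
  proof (induction k)
    case (Suc k)
    then show ?case using closed[of "p + (i + k)"] annular_cycle_right[of "i + k" q p] by simp
  qed simp
  have "p + q \<in> X" using up[of "j - p" "q - (j - p)"] assms(2,3) by auto
  then have 1: "p + 1 \<in> X" using closed[of "p + q"] annular_cycle_right[of q q p] assms(3) by simp
  have "x \<in> X" if "x \<in> {p + 1..p + q}" for x
  proof -
    have "x = p + (1 + (x - p - 1))" "1 + (x - p - 1) \<le> q" using that by auto
    then show ?thesis using up[of 1 "x - p - 1"] 1 by simp
  qed
  then show ?thesis by blast
qed

section \<open>Orientation reversing exchanges of two circles of equal length\<close>

text \<open>The point and its image lie on different circles and add up to \<open>c + 1\<close>
  modulo \<open>p\<close>; for \<open>c\<close> in \<open>{1..p}\<close> the point \<open>1\<close>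
  goes to \<open>p + c\<close>. The parameter is an integer so that it can be lowered without
  truncation.\<close>

definition reflection :: "nat \<Rightarrow> int \<Rightarrow> nat \<Rightarrow> nat" where
  "reflection p c x =
    (if x \<in> {1..p} then p + 1 + nat ((c - int x) mod int p)
     else if x \<in> {p + 1..p + p} then 1 + nat ((c - int x) mod int p) else x)"

lemma reflection_left: "x \<in> {1..p} \<Longrightarrow> reflection p c x \<in> {p + 1..p + p}"
  and reflection_right: "x \<in> {p + 1..p + p} \<Longrightarrow> reflection p c x \<in> {1..p}"
  by (auto simp: reflection_def Suc_le_eq nat_less_iff)

lemma dvd_interval_eq:
  assumes "int p dvd int x - int y" "x \<in> {k + 1..k + p}" "y \<in> {k + 1..k + p}"
  shows "x = y"
proof -
  have "\<bar>int x - int y\<bar> < int p" using assms(2,3) by auto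
  then have "int x - int y = 0"
    using assms(1) zdvd_imp_le[of "int p" "\<bar>int x - int y\<bar>"] by fastforce
  then show ?thesis by simp
qed

lemma reflection_dvd:
  assumes "x \<in> {1..p + p}"
  shows "int p dvd int (reflection p c x) + int x - (c + 1)"
proof -
  have "int p dvd (c - int x) mod int p - (c - int x)"
    by (simp flip: mod_eq_dvd_iff)
  \<comment> \<open>The multiple \<open>k\<close> absorbs the offset of the second circle:
    \<open>k = 1\<close> serves points of the first circle, whose images lie on the second, and
    \<open>k = 0\<close> the others.\<close>
  then have "int p dvd int p * k + ((c - int x) mod int p - (c - int x))" for k
    by (rule dvd_add[OF dvd_triv_left])
  from this[of 0] this[of 1] show ?thesis
    using assms by (simp add: reflection_def algebra_simps)
qed

text \<open>The congruence determines the image modulo \<open>p\<close>, and the circle selects the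
  representative. Identities between reflections thus reduce to adding congruences.\<close>

lemma reflection_eqI:
  assumes "int p dvd int x + int y - (c + 1)"
    and "x \<in> {1..p} \<and> y \<in> {p + 1..p + p} \<or> x \<in> {p + 1..p + p} \<and> y \<in> {1..p}"
  shows "reflection p c x = y"
proof -
  have "int p dvd int (reflection p c x) + int x - (c + 1)"
    using assms(2) by (intro reflection_dvd) auto
  from dvd_diff[OF this assms(1)] have "int p dvd int (reflection p c x) - int y" by simp
  with assms(2) show ?thesis
    using reflection_left[of x p c] reflection_right[of x p c]
      dvd_interval_eq[of p _ _ 0] dvd_interval_eq[of p _ _ p] by fastforce
qed

lemma reflection_outside: "x \<notin> {1..p + p} \<Longrightarrow> reflection p c x = x"
  by (auto simp: reflection_def)

text \<open>The congruence between a point and its image is symmetric in the two.\<close>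

lemma reflection_involution: "reflection p c (reflection p c x) = x"
proof (cases "x \<in> {1..p + p}")
  case True
  then have "x \<in> {1..p} \<or> x \<in> {p + 1..p + p}" by auto
  then show ?thesis
    using reflection_dvd[OF True, of c] reflection_left[of x p c] reflection_right[of x p c]
    by (intro reflection_eqI) auto
qed (simp add: reflection_outside)

lemma reflection_permutes: "reflection p c permutes {1..p + p}"
  unfolding permutes_def
proof (intro conjI allI impI ex1I)
  show "reflection p c x = x" if "x \<notin> {1..p + p}" for x
    using that by (rule reflection_outside)
  show "reflection p c (reflection p c y) = y" for y
    by (rule reflection_involution)
  show "x = reflection p c y" if "reflection p c x = y" for x y
    using reflection_involution[of p c x] that by simp
qed

lemma inv_reflection: "inv (reflection p c) = reflection p c"
  by (rule inv_unique_comp) (auto simp: reflection_involution)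

lemma annular_cycle_dvd:
  assumes "x \<in> {1..p + p}"
  shows "int p dvd int (annular_cycle p p x) - int x - 1"
proof -
  have *: "int p dvd int (i mod p) - int i" for i
    by (simp add: zmod_int flip: mod_eq_dvd_iff)
  show ?thesis
  proof (cases "x \<le> p")
    case True
    then show ?thesis using assms *[of x] by (simp add: annular_cycle_left)
  next
    case False
    then have "x \<in> {p + 1..p + p}" using assms by auto
    then obtain j where "x = p + j" "j \<in> {1..p}" by (rule right_circleE)
    then show ?thesis using *[of j] annular_cycle_right[of j p p] by simp
  qed
qed

lemma annular_cycle_mem_left: "x \<in> {1..p} \<Longrightarrow> annular_cycle p q x \<in> {1..p}"
  by (auto simp: annular_cycle_left Suc_le_eq)

lemma annular_cycle_mem_right:
  assumes "x \<in> {p + 1..p + q}"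
  shows "annular_cycle p q x \<in> {p + 1..p + q}"
proof -
  from assms obtain j where "x = p + j" "j \<in> {1..q}" by (rule right_circleE)
  then show ?thesis using annular_cycle_right[of j q p] by (auto simp: Suc_le_eq)
qed

text \<open>On each circle \<open>annular_cycle p p\<close> adds 1 modulo \<open>p\<close>, which
  lowers the constant sum by one. So the complement
  \<open>inv \<pi> \<circ> annular_cycle p p\<close> of a reflection \<pi> is again a reflection,
  and its cycles need no separate count.\<close>

lemma reflection_annular_cycle: "reflection p c \<circ> annular_cycle p p = reflection p (c - 1)"
proof
  fix x
  show "(reflection p c \<circ> annular_cycle p p) x = reflection p (c - 1) x"
  proof (cases "x \<in> {1..p + p}")
    case True
    have "int p dvd int (annular_cycle p p x) - int x - 1"
      "int p dvd int (reflection p (c - 1) x) + int x - (c - 1 + 1)"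
      using True by (rule annular_cycle_dvd reflection_dvd)+
    from dvd_add[OF this]
    have "int p dvd int (annular_cycle p p x) + int (reflection p (c - 1) x) - (c + 1)"
      by (simp add: algebra_simps)
    moreover have "x \<in> {1..p} \<or> x \<in> {p + 1..p + p}" using True by auto
    ultimately have "reflection p c (annular_cycle p p x) = reflection p (c - 1) x"
      using reflection_left[of x p "c - 1"] reflection_right[of x p "c - 1"]
        annular_cycle_mem_left[of x p p] annular_cycle_mem_right[of x p p]
      by (intro reflection_eqI) blast+
    then show ?thesis by simp
  next
    case False
    then show ?thesis
      using permutes_not_in[OF annular_cycle_permutes[of p p] False]
      by (simp add: reflection_outside)
  qed
qed

text \<open>Each cycle is a pair with exactly one point on the first circle, so that circle indexes
  the cycles. This serves both the cycle count and the reindexing of products over cycles.\<close>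

lemma cycle_partition_reflection:
  "cycle_partition {1..p + p} (reflection p c) = (\<lambda>i. {i, reflection p c i}) ` {1..p}"
  "inj_on (\<lambda>i. {i, reflection p c i}) {1..p}"
proof -
  have orb: "orbit (reflection p c) x = {x, reflection p c x}" for x
    by (intro orbit_involution reflection_involution)
  show "cycle_partition {1..p + p} (reflection p c) = (\<lambda>i. {i, reflection p c i}) ` {1..p}"
  proof
    show "(\<lambda>i. {i, reflection p c i}) ` {1..p} \<subseteq> cycle_partition {1..p + p} (reflection p c)"
      by (auto simp: cycle_partition_def orb)
    show "cycle_partition {1..p + p} (reflection p c) \<subseteq> (\<lambda>i. {i, reflection p c i}) ` {1..p}"
    proof
      fix V assume "V \<in> cycle_partition {1..p + p} (reflection p c)"
      then obtain x where x: "x \<in> {1..p + p}" "V = {x, reflection p c x}"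
        by (auto simp: cycle_partition_def orb)
      show "V \<in> (\<lambda>i. {i, reflection p c i}) ` {1..p}"
      proof (cases "x \<le> p")
        case False
        then have "reflection p c x \<in> {1..p}" using x(1) by (intro reflection_right) auto
        then show ?thesis using x(2) reflection_involution[of p c x]
          by (intro image_eqI[of _ _ "reflection p c x"]) auto
      qed (use x in auto)
    qed
  qed
  show "inj_on (\<lambda>i. {i, reflection p c i}) {1..p}"
  proof (rule inj_onI)
    fix i j assume "i \<in> {1..p}" "j \<in> {1..p}" "{i, reflection p c i} = {j, reflection p c j}"
    then show "i = j"
      using reflection_left[of j p c] by (auto simp: doubleton_eq_iff)
  qed
qed

lemma num_cycles_reflection: "num_cycles {1..p + p} (reflection p c) = p"
  unfolding num_cycles_def cycle_partition_reflection(1)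
  by (simp add: card_image cycle_partition_reflection(2) del: One_nat_def)

text \<open>The reflection and its complement have \<open>p\<close> cycles each, which is the
  required count. For the join, take a partition coarser than both cycle partitions: the block of
  \<open>1\<close> contains the first circle, then the image of \<open>1\<close>, then the second
  circle.\<close>

lemma reflection_in_S_NC:
  assumes "p \<ge> 1"
  shows "reflection p c \<in> S_NC p p"
proof -
  let ?S = "{1..p + p}" and ?\<rho> = "reflection p c" and ?\<gamma> = "annular_cycle p p"
  have part: "partition_on ?S (cycle_partition ?S ?\<rho>)" "partition_on ?S (cycle_partition ?S ?\<gamma>)"
    by (intro partition_on_cycle_partition reflection_permutes annular_cycle_permutes finite_atLeastAtMost)+
  have top: "partition_on ?S {?S}" using assms by (intro partition_on_space) auto
  have "refines ?S {?S} R"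
    if R: "refines ?S (cycle_partition ?S ?\<rho>) R" "refines ?S (cycle_partition ?S ?\<gamma>) R" for R
  proof -
    have pR: "partition_on ?S R" using R(1) by (simp add: refines_def)
    have stay: "f x \<in> X"
      if f: "refines ?S (cycle_partition ?S f) R" "f permutes ?S" and "X \<in> R" "x \<in> X" for f x X
    proof -
      have x: "x \<in> ?S" using pR \<open>X \<in> R\<close> \<open>x \<in> X\<close> partition_onD1 by blast
      then have "orbit f x \<in> cycle_partition ?S f" by (simp add: cycle_partition_def)
      then obtain Y where Y: "Y \<in> R" "orbit f x \<subseteq> Y" using f(1) by (auto simp: refines_def)
      have "x \<in> orbit f x"
        using f(2) by (intro permutation_self_in_orbit) (auto simp: permutation_permutes)
      then have "X = Y"
        using Y \<open>X \<in> R\<close> \<open>x \<in> X\<close> \<open>x \<in> orbit f x\<close> partition_onD2[OF pR] by (auto simp: disjoint_def)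
      then show ?thesis using Y orbit.base[of f x] by auto
    qed
    obtain X where X: "X \<in> R" "1 \<in> X"
      using partition_onD1[OF pR] assms by (metis One_nat_def Suc_le_eq UnionE add_gr_0 atLeastAtMost_iff order_refl)
    have closed: "?\<gamma> i \<in> X" if "i \<in> X" for i
      using stay[OF R(2) annular_cycle_permutes X(1) that] .
    have L: "{1..p} \<subseteq> X"
      using annular_cycle_invariant_left[OF closed X(2)] assms by simp
    have "?\<rho> 1 \<in> X" using stay[OF R(1) reflection_permutes X] .
    then have "{p + 1..p + p} \<subseteq> X"
      using annular_cycle_invariant_right[OF closed] reflection_left[of 1 p c] assms by simp
    moreover have "?S = {1..p} \<union> {p + 1..p + p}" by auto
    ultimately have "?S \<subseteq> X" using L by blast
    then show ?thesis using pR top X(1) by (auto simp: refines_def)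
  qed
  moreover have "refines ?S (cycle_partition ?S ?\<rho>) {?S}" "refines ?S (cycle_partition ?S ?\<gamma>) {?S}"
    using part top by (auto simp: refines_def dest: partition_onD1)
  moreover have "num_cycles ?S ?\<rho> + num_cycles ?S (inv ?\<rho> \<circ> ?\<gamma>) = p + p"
    by (simp only: inv_reflection reflection_annular_cycle num_cycles_reflection)
  ultimately show ?thesis
    unfolding S_NC_def is_partition_join_def using reflection_permutes by blast
qed

text \<open>For even \<open>p\<close> the congruence can be read modulo 2, where
  \<open>c + 1\<close> vanishes for odd \<open>c\<close>.\<close>

lemma reflection_parity:
  assumes "even p" "odd c" "x \<in> {1..p + p}"
  shows "odd (reflection p c x) \<longleftrightarrow> odd x"
proof -
  have "2 dvd int (reflection p c x) + int x - (c + 1)"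
    using reflection_dvd[OF assms(3), of c] assms(1) by (meson dvd_trans even_of_nat_iff)
  then show ?thesis using assms(2) by simp
qed

section \<open>Parity preserving pairings in \<open>S_NC\<close>\<close>

lemma S_NC_permutes: "\<pi> \<in> S_NC p q \<Longrightarrow> \<pi> permutes {1..p + q}"
  by (simp add: S_NC_def)

text \<open>Otherwise \<pi> maps the first circle into itself, hence onto itself by finiteness, and
  so preserves the second one too. The partition into the two circles is then coarser than both
  cycle partitions, although their join has a single block.\<close>

lemma S_NC_connects_circles:
  assumes "\<pi> \<in> S_NC p q" "p \<ge> 1" "q \<ge> 1"
  shows "\<exists>x\<in>{1..p}. \<pi> x \<in> {p + 1..p + q}"
proof (rule ccontr)
  assume no: "\<not> (\<exists>x\<in>{1..p}. \<pi> x \<in> {p + 1..p + q})"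
  let ?S = "{1..p + q}" and ?L = "{1..p}" and ?R = "{p + 1..p + q}" and ?\<gamma> = "annular_cycle p q"
  have S: "?S = ?L \<union> ?R" by auto
  have \<pi>: "\<pi> permutes ?S" using assms(1) by (rule S_NC_permutes)
  have L: "\<pi> x \<in> ?L" if "x \<in> ?L" for x
    using that no permutes_in_image[OF \<pi>, of x] S by blast
  have "\<pi> ` ?L = ?L"
    using L permutes_inj_on[OF \<pi>] by (intro endo_inj_surj) auto
  then have R: "\<pi> x \<in> ?R" if "x \<in> ?R" for x
  proof -
    have "\<pi> x \<notin> ?L"
    proof
      assume "\<pi> x \<in> ?L"
      then have "\<pi> x \<in> \<pi> ` ?L" using \<open>\<pi> ` ?L = ?L\<close> by simp
      then obtain y where "y \<in> ?L" "\<pi> x = \<pi> y" by (rule imageE)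
      then have "x \<in> ?L" using injD[OF permutes_inj[OF \<pi>], of x y] by simp
      then show False using that by simp
    qed
    then show ?thesis using that permutes_in_image[OF \<pi>, of x] S by blast
  qed
  have orbit_sub: "orbit f x \<subseteq> A" if "\<And>y. y \<in> A \<Longrightarrow> f y \<in> A" "x \<in> A" for f :: "nat \<Rightarrow> nat" and x A
  proof
    fix y assume "y \<in> orbit f x"
    then show "y \<in> A" by induct (auto simp: that)
  qed
  have part: "partition_on ?S {?L, ?R}"
    using assms(2,3) by (auto simp: partition_on_def disjoint_def)
  have "refines ?S (cycle_partition ?S f) {?L, ?R}"
    if "f permutes ?S" "\<And>x. x \<in> ?L \<Longrightarrow> f x \<in> ?L" "\<And>x. x \<in> ?R \<Longrightarrow> f x \<in> ?R" for f
    unfolding refines_def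
  proof (intro conjI ballI part partition_on_cycle_partition that(1) finite_atLeastAtMost)
    fix V assume "V \<in> cycle_partition ?S f"
    then obtain x where "x \<in> ?L \<or> x \<in> ?R" "V = orbit f x"
      unfolding cycle_partition_def S by blast
    then show "\<exists>Y\<in>{?L, ?R}. V \<subseteq> Y"
      using orbit_sub[of ?L f x] orbit_sub[of ?R f x] that(2,3) by blast
  qed
  from this[OF \<pi> L R]
    this[OF annular_cycle_permutes annular_cycle_mem_left annular_cycle_mem_right]
  have "refines ?S {?S} {?L, ?R}"
    using assms(1) unfolding S_NC_def is_partition_join_def by blast
  then have "?S \<subseteq> ?L \<or> ?S \<subseteq> ?R" by (auto simp: refines_def)
  moreover have "1 \<in> ?S" "p + q \<in> ?S" using assms(2,3) by auto
  ultimately have "1 \<in> ?R \<or> p + q \<in> ?L" by blast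
  then show False using assms(2,3) by auto
qed

text \<open>Since \<pi> preserves parity and \<open>annular_cycle p q\<close> reverses it, their
  composition moves every point, so its cycles have length at least 2. The pairing \<pi> uses half
  of the \<open>p + q\<close> cycles allowed in total; the other half is left for the composition,
  whose average cycle length is therefore exactly 2.\<close>

lemma S_NC_pairing_reverses:
  assumes \<pi>: "\<pi> \<in> S_NC p q" and even: "even p" "even q"
    and parity: "\<And>i. i \<in> {1..p + q} \<Longrightarrow> odd (\<pi> i) \<longleftrightarrow> odd i"
    and pairing: "\<And>V. V \<in> cycle_partition {1..p + q} \<pi> \<Longrightarrow> card V = 2"
    and i: "i \<in> {1..p + q}"
  shows "\<pi> (\<pi> i) = i" "annular_cycle p q (\<pi> (annular_cycle p q i)) = \<pi> i"
proof -
  let ?S = "{1..p + q}" and ?\<gamma> = "annular_cycle p q"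
  have perm: "\<pi> permutes ?S" using \<pi> by (rule S_NC_permutes)
  then have "permutation \<pi>" using permutation_permutes by blast
  then have inS: "\<pi> (\<pi> x) = x" if "x \<in> ?S" for x
    using orbit_card_two(2)[OF \<open>permutation \<pi>\<close>] pairing[of "orbit \<pi> x"] that by (simp add: cycle_partition_def)
  then have invol: "\<pi> (\<pi> x) = x" for x
    using permutes_not_in[OF perm] by metis
  then have inv: "inv \<pi> = \<pi>" by (intro inv_unique_comp) (auto simp: fun_eq_iff)
  show "\<pi> (\<pi> i) = i" by (rule invol)
  let ?\<tau> = "\<pi> \<circ> ?\<gamma>"
  have \<tau>: "?\<tau> permutes ?S" by (intro permutes_compose annular_cycle_permutes perm)
  then have perm\<tau>: "permutation ?\<tau>" using permutation_permutes by blast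
  have \<tau>_parity: "odd (?\<tau> x) \<longleftrightarrow> even x" if "x \<in> ?S" for x
    using annular_cycle_parity[OF even that] parity[of "?\<gamma> x"] that
      permutes_in_image[OF annular_cycle_permutes[of p q], of x] by simp
  let ?C = "cycle_partition ?S"
  have fin: "finite (?C f)" for f :: "nat \<Rightarrow> nat" by (intro finite_cycle_partition) simp
  have ge2: "2 \<le> card V" if V: "V \<in> ?C ?\<tau>" for V
  proof -
    obtain x where x: "x \<in> ?S" "V = orbit ?\<tau> x" using V by (auto simp: cycle_partition_def)
    have "x \<in> V" "?\<tau> x \<in> V" "finite V"
      unfolding x(2) using permutation_self_in_orbit[OF perm\<tau>]
      by (blast intro: orbit.base finite_orbit)+
    moreover have "?\<tau> x \<noteq> x" using \<tau>_parity[OF x(1)] by metis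
    ultimately have "card {x, ?\<tau> x} \<le> card V" by (intro card_mono) auto
    then show ?thesis using \<open>?\<tau> x \<noteq> x\<close> by simp
  qed
  have "2 * card (?C \<pi>) = p + q"
    using sum_card_cycle_partition[OF perm] pairing by (simp del: One_nat_def)
  moreover have "card (?C \<pi>) + card (?C ?\<tau>) = p + q"
    using \<pi> by (simp add: S_NC_def num_cycles_def inv)
  ultimately have "(\<Sum>V\<in>?C ?\<tau>. card V) = (\<Sum>V\<in>?C ?\<tau>. 2)"
    using sum_card_cycle_partition[OF \<tau>] by (simp del: One_nat_def)
  \<comment> \<open>All lengths are at least 2 and they add up to twice the number of cycles, so
    equality holds for each cycle.\<close>
  then have two: "card V = 2" if "V \<in> ?C ?\<tau>" for V
    using sum_mono_inv[of "\<lambda>_. 2" "?C ?\<tau>" card V] ge2 that fin by simp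
  have "?\<tau> (?\<tau> i) = i"
    using orbit_card_two(2)[OF perm\<tau>, of i] two[of "orbit ?\<tau> i"] i by (simp add: cycle_partition_def)
  \<comment> \<open>The outermost \<pi> in \<pi> \<gamma> \<pi> \<gamma> i = i is removed by
    applying the involution \<pi>.\<close>
  then show "?\<gamma> (\<pi> (?\<gamma> i)) = \<pi> i"
    using invol by (metis comp_apply)
qed

text \<open>The relation \<gamma> \<pi> \<gamma> = \<pi> makes crossing to the other circle an
  all-or-nothing property, and injectivity in both directions then forces equal lengths. The same
  relation computes each value of \<pi> on the first circle from the preceding one, so \<pi> is
  determined by its value at \<open>1\<close>.\<close>

lemma S_NC_pairing_reflection:
  assumes \<pi>: "\<pi> \<in> S_NC p q" and even: "even p" "even q" and pos: "p \<ge> 1" "q \<ge> 1"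
    and parity: "\<And>i. i \<in> {1..p + q} \<Longrightarrow> odd (\<pi> i) \<longleftrightarrow> odd i"
    and pairing: "\<And>V. V \<in> cycle_partition {1..p + q} \<pi> \<Longrightarrow> card V = 2"
  shows "p = q" "\<exists>c\<in>{1..p}. odd c \<and> \<pi> = reflection p (int c)"
proof -
  let ?S = "{1..p + q}" and ?L = "{1..p}" and ?R = "{p + 1..p + q}" and ?\<gamma> = "annular_cycle p q"
  have perm: "\<pi> permutes ?S" using \<pi> by (rule S_NC_permutes)
  have inj\<gamma>: "inj ?\<gamma>" using annular_cycle_permutes by (rule permutes_inj)
  have inS: "x \<in> ?S" if "x \<in> ?L \<or> x \<in> ?R" for x using that by auto
  note rev = S_NC_pairing_reverses[OF \<pi> even parity pairing]
  \<comment> \<open>The reversal relation locates \<gamma> (\<pi> (\<gamma> x)); this fact and the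
    next one strip off the outer \<gamma> without leaving the circle.\<close>
  have \<gamma>R: "y \<in> ?R" if "?\<gamma> y \<in> ?R" for y
  proof (rule ccontr)
    assume "y \<notin> ?R"
    show False
    proof (cases "y \<in> ?L")
      case True
      from annular_cycle_mem_left[OF this, of q] that show False by auto
    next
      case False
      then have "y \<notin> ?S" using \<open>y \<notin> ?R\<close> by auto
      from permutes_not_in[OF annular_cycle_permutes this] that \<open>y \<notin> ?R\<close> show False by simp
    qed
  qed
  have \<gamma>L: "y \<in> ?L" if "?\<gamma> y \<in> ?L" for y
  proof (rule ccontr)
    assume "y \<notin> ?L"
    show False
    proof (cases "y \<in> ?R")
      case True
      from annular_cycle_mem_right[OF this] that show False by auto
    next
      case False
      then have "y \<notin> ?S" using \<open>y \<notin> ?L\<close> by auto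
      from permutes_not_in[OF annular_cycle_permutes this] that \<open>y \<notin> ?L\<close> show False by simp
    qed
  qed
  obtain x0 where x0: "x0 \<in> ?L" "\<pi> x0 \<in> ?R" using S_NC_connects_circles[OF \<pi> pos] by blast
  have L: "\<pi> x \<in> ?R" if "x \<in> ?L" for x
  proof -
    \<comment> \<open>By the reversal relation \<pi> (\<gamma> x) lies on the same circle as \<pi>
      x, so the set of crossing points is closed under \<gamma>; it contains
      \<open>x0\<close>.\<close>
    have "?\<gamma> x \<in> {x \<in> ?L. \<pi> x \<in> ?R}" if "x \<in> {x \<in> ?L. \<pi> x \<in> ?R}" for x
      using that rev(2)[of x] \<gamma>R[of "\<pi> (?\<gamma> x)"] annular_cycle_mem_left[of x p q] inS[of x] by auto
    from annular_cycle_invariant_left[OF this, of x0] show ?thesis using x0 that by auto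
  qed
  have R: "\<pi> x \<in> ?L" if "x \<in> ?R" for x
  proof -
    have "?\<gamma> x \<in> {x \<in> ?R. \<pi> x \<in> ?L}" if "x \<in> {x \<in> ?R. \<pi> x \<in> ?L}" for x
      using that rev(2)[of x] \<gamma>L[of "\<pi> (?\<gamma> x)"] annular_cycle_mem_right[of x p q] inS[of x] by auto
    from annular_cycle_invariant_right[OF this, of "\<pi> x0"] show ?thesis
      using x0 that rev(1)[of x0] inS[of x0] by auto
  qed
  have inj: "inj_on \<pi> A" for A using perm by (rule permutes_inj_on)
  have "card ?L \<le> card ?R" using L by (intro card_inj_on_le[OF inj]) auto
  moreover have "card ?R \<le> card ?L" using R by (intro card_inj_on_le[OF inj]) auto
  ultimately show pq: "p = q" by simp
  \<comment> \<open>This is the position of the image of \<open>1\<close> on the second circle; it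
    is odd because \<pi> preserves parity and \<open>p\<close> is even.\<close>
  define c where "c = \<pi> 1 - p"
  have \<pi>1: "\<pi> 1 = p + c" and c: "c \<in> {1..p}"
    using L[of 1] pos by (auto simp: c_def pq)
  have "odd c" using parity[of 1] even pos \<pi>1 by simp
  let ?\<rho> = "reflection p (int c)"
  have left: "\<pi> x = ?\<rho> x" if "x \<in> ?L" for x
  proof -
    have "k + 1 \<le> p \<Longrightarrow> \<pi> (k + 1) = ?\<rho> (k + 1)" for k
    proof (induction k)
      case 0
      have "?\<rho> 1 = \<pi> 1"
        by (rule reflection_eqI) (use pos c \<pi>1 in auto)
      then show ?case by simp
    next
      case (Suc k)
      have \<gamma>: "?\<gamma> (k + 1) = Suc k + 1" using Suc.prems annular_cycle_left[of "k + 1" p q] by simp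
      \<comment> \<open>The reflection obeys the same recursion as \<pi>, because its composition
        with \<gamma> is again a reflection and thus an involution. Injectivity of \<gamma> then
        carries agreement from \<open>k + 1\<close> to the next point.\<close>
      have "?\<rho> (?\<gamma> (?\<rho> (?\<gamma> (k + 1)))) = k + 1"
        using reflection_annular_cycle[of p "int c"] reflection_involution[of p "int c - 1" "k + 1"]
        by (metis comp_apply pq)
      then have "?\<gamma> (?\<rho> (?\<gamma> (k + 1))) = ?\<rho> (k + 1)"
        using reflection_involution by metis
      also have "\<dots> = \<pi> (k + 1)" using Suc by simp
      also have "\<dots> = ?\<gamma> (\<pi> (?\<gamma> (k + 1)))" using rev(2)[of "k + 1"] Suc.prems by simp
      finally show ?case using \<gamma> injD[OF inj\<gamma>] by metis
    qed
    from this[of "x - 1"] that show ?thesis by simp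
  qed
  have "\<pi> x = ?\<rho> x" for x
  proof -
    consider "x \<in> ?L" | "x \<in> ?R" | "x \<notin> ?S" by force
    then show ?thesis
    proof cases
      \<comment> \<open>The reflected point lies on the first circle, where both maps agree; since
        both are involutions, they agree at \<open>x\<close> too.\<close>
      case 2
      then have "?\<rho> x \<in> ?L" using reflection_right[of x p] pq by simp
      then have "\<pi> (?\<rho> x) = x" "?\<rho> x \<in> ?S" using left reflection_involution by auto
      then show ?thesis using rev(1)[of "?\<rho> x"] by simp
    next
      case 3
      then show ?thesis using permutes_not_in[OF perm] reflection_outside[of x p] pq by simp
    qed (rule left)
  qed
  then show "\<exists>c\<in>{1..p}. odd c \<and> \<pi> = reflection p (int c)"
    using c \<open>odd c\<close> by blast
qed

section \<open>Non-crossing pairings\<close>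

text \<open>A pair \<open>{i, j}\<close> of least distance is adjacent. Otherwise the partner of
  \<open>i + 1\<close> lies outside, which gives a crossing, or strictly inside, which gives a
  closer pair.\<close>

lemma NC_pairing_adjacent:
  assumes "P \<in> NC {k + 1..k + n}" "n \<ge> 1" "\<And>V. V \<in> P \<Longrightarrow> card V = 2"
  obtains i where "{i, i + 1} \<in> P"
proof -
  have part: "partition_on {k + 1..k + n} P"
    and nc: "\<And>A B. A \<in> P \<Longrightarrow> B \<in> P \<Longrightarrow> A \<noteq> B \<Longrightarrow> \<not> crossing A B"
    using assms(1) by (auto simp: NC_def)
  have pair: "\<exists>i j. V = {i, j} \<and> i < j" if V: "V \<in> P" for V
  proof -
    obtain i j where "V = {i, j}" "i \<noteq> j" using assms(3)[OF V] by (auto simp: card_2_iff)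
    then show ?thesis by (metis insert_commute nat_neq_iff)
  qed
  have block: "\<exists>V\<in>P. x \<in> V" if "x \<in> {k + 1..k + n}" for x
    using that partition_onD1[OF part] by auto
  have mem: "x \<in> {k + 1..k + n}" if "V \<in> P" "x \<in> V" for x V
    using that partition_onD1[OF part] by auto
  define gap where "gap d \<longleftrightarrow> (\<exists>i j. {i, j} \<in> P \<and> i < j \<and> j - i = d)" for d
  have "k + 1 \<in> {k + 1..k + n}" using assms(2) by simp
  then have "\<exists>d. gap d" using block pair unfolding gap_def by metis
  define d where "d = (LEAST d. gap d)"
  have "gap d" and least: "\<And>e. gap e \<Longrightarrow> d \<le> e"
    unfolding d_def using LeastI_ex[OF \<open>\<exists>d. gap d\<close>] Least_le by auto
  then obtain i j where ij: "{i, j} \<in> P" "i < j" "j - i = d" by (auto simp: gap_def)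
  have "j = i + 1"
  proof (rule ccontr)
    assume "j \<noteq> i + 1"
    then have lt: "i + 1 < j" using ij(2) by simp
    have "i + 1 \<in> {k + 1..k + n}" using mem[OF ij(1)] lt by force
    then obtain V where V: "V \<in> P" "i + 1 \<in> V" using block by blast
    then obtain l where l: "V = {i + 1, l}" "l \<noteq> i + 1" using pair[OF V(1)] by auto
    have ne: "V \<noteq> {i, j}" using V(2) lt by auto
    then have "V \<inter> {i, j} = {}" using partition_onD2[OF part] V(1) ij(1) by (auto simp: disjoint_def)
    then have "l \<noteq> i" "l \<noteq> j" using l by auto
    then consider "l < i" | "i + 1 < l" "l < j" | "j < l" using l(2) by linarith
    then show False
    proof cases
      case 1
      then have "crossing V {i, j}" using l lt unfolding crossing_def by force
      then show False using nc[OF V(1) ij(1) ne] by simp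
    next
      case 2
      then have "gap (l - (i + 1))" using V(1) l unfolding gap_def by blast
      then show False using least[of "l - (i + 1)"] 2 ij by auto
    next
      case 3
      then have "crossing {i, j} V" using l lt unfolding crossing_def by force
      then show False using nc[OF ij(1) V(1)] ne by simp
    qed
  qed
  then show thesis using ij(1) that by blast
qed

section \<open>Cumulants and moments of alternating words\<close>

text \<open>The form \<open>[c, c]\<close> records two things at once: the block has two elements,
  and they have equal parity. If all blocks had this form, there would be an adjacent pair
  \<open>{i, i + 1}\<close>, whose parities differ.\<close>

lemma NC_parity_pairing_impossible:
  assumes "P \<in> NC {k + 1..k + n}" "n \<ge> 1"
  shows "\<exists>V\<in>P. \<forall>c. map odd (sorted_list_of_set V) \<noteq> [c, c]"
proof (rule ccontr)
  assume "\<not> ?thesis"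
  then have *: "\<exists>c. map odd (sorted_list_of_set V) = [c, c]" if "V \<in> P" for V
    using that by metis
  have "card V = 2" if "V \<in> P" for V
  proof -
    from *[OF that] obtain c where "map odd (sorted_list_of_set V) = [c, c]" ..
    from arg_cong[OF this, of length] show ?thesis by simp
  qed
  from NC_pairing_adjacent[OF assms this] obtain i where "{i, i + 1} \<in> P" .
  from *[OF this] show False by simp
qed

text \<open>Positions count from 1 and list indices from 0, so the label at position
  \<open>i\<close> is \<open>even (i - 1)\<close>, that is, \<open>odd i\<close>: odd positions
  carry \<open>a\<close>.\<close>

lemma entries_alternating:
  assumes "set is \<subseteq> {1..N}"
  shows "entries (choose_args a b (map even [0..<N])) is = choose_args a b (map odd is)"
proof -
  have "i \<ge> 1 \<and> i - 1 < N" if "i \<in> set is" for i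
    using assms that by fastforce
  then show ?thesis
    by (auto simp: entries_def choose_args_def)
qed

lemma prod_list_alternating:
  fixes a b :: "'a::monoid_mult"
  shows "prod_list (choose_args a b (map even [0..<2 * n])) = (a * b) ^ n"
  by (induction n) (simp_all add: choose_args_def power_Suc2 mult.assoc del: power_Suc)

lemma alternating_append:
  "choose_args a b (map even [0..<2 * n]) @ choose_args a b (map even [0..<2 * m]) =
    choose_args a b (map even [0..<2 * n + 2 * m])"
  by (rule nth_equalityI) (auto simp: choose_args_def nth_append)

lemma choose_args_not_mixed:
  assumes "\<not> mixed cs" "cs \<noteq> []"
  obtains c where "cs = replicate (length cs) c"
    "choose_args a b cs = replicate (length cs) (if c then a else b)"
proof -
  have "x = hd cs" if "x \<in> set cs" for x
    using assms(1) hd_in_set[OF assms(2)] that unfolding mixed_def by (cases x; cases "hd cs") simp_all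
  then have eq: "cs = replicate (length cs) (hd cs)"
    by (simp add: replicate_length_same)
  then have "choose_args a b cs = replicate (length cs) (if hd cs then a else b)"
    unfolding choose_args_def by (metis length_replicate map_replicate)
  with eq show thesis by (rule that)
qed

lemma replicate_two: "replicate 2 x = [x, x]"
  by (simp add: numeral_2_eq_2)

section \<open>Nonvanishing cumulants of two free semicircular variables\<close>

text \<open>Freeness kills mixed label words, and semicircularity kills constant words of length
  other than 2.\<close>

lemma free_semicircular_cumulant:
  assumes "second_order_semicircular \<phi> \<phi>2 a" "second_order_semicircular \<phi> \<phi>2 b"
    and "second_order_free \<phi> \<phi>2 a b" "cs \<noteq> []"
    and nz: "free_cumulant \<phi> (choose_args a b cs) \<noteq> 0"
  shows "\<exists>c. cs = [c, c]"
proof -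
  have len: "length cs \<ge> 1" using assms(4) by (simp add: Suc_le_eq)
  have "\<not> mixed cs"
  proof
    assume "mixed cs"
    \<comment> \<open>Freeness speaks of words of length at least 2; a single label is never
      mixed.\<close>
    then have "length cs \<noteq> 1" by (auto simp: mixed_def length_Suc_conv)
    then show False using assms(3) nz len \<open>mixed cs\<close> by (auto simp: second_order_free_def)
  qed
  then obtain c where c: "cs = replicate (length cs) c"
    "choose_args a b cs = replicate (length cs) (if c then a else b)"
    using choose_args_not_mixed assms(4) by metis
  then have "length cs = 2"
    using assms(1,2) nz len unfolding second_order_semicircular_def by (metis (full_types))
  then show ?thesis using c(1) replicate_two by metis
qed

text \<open>Freeness concerns the concatenated labels, so it also excludes a constant word in
  \<open>a\<close> on one circle together with a constant word in \<open>b\<close> on the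
  other.\<close>

lemma free_semicircular_second_order_cumulant:
  assumes "second_order_semicircular \<phi> \<phi>2 a" "second_order_semicircular \<phi> \<phi>2 b"
    and "second_order_free \<phi> \<phi>2 a b" "cs \<noteq> []" "ds \<noteq> []"
    and nz: "second_order_cumulant \<phi> \<phi>2 (choose_args a b cs) (choose_args a b ds) \<noteq> 0"
  shows "\<exists>c. cs = [c, c] \<and> ds = [c, c]"
proof -
  have len: "length cs \<ge> 1" "length ds \<ge> 1" using assms(4,5) by (simp_all add: Suc_le_eq)
  then have nm: "\<not> mixed (cs @ ds)" using assms(3) nz by (auto simp: second_order_free_def)
  then have "\<not> mixed cs" "\<not> mixed ds" by (auto simp: mixed_def)
  then obtain c d where c: "cs = replicate (length cs) c"
    "choose_args a b cs = replicate (length cs) (if c then a else b)"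
    and d: "ds = replicate (length ds) d"
    "choose_args a b ds = replicate (length ds) (if d then a else b)"
    using choose_args_not_mixed assms(4,5) by metis
  have "c \<in> set cs" "d \<in> set ds" using c(1) d(1) len
    by (metis in_set_replicate not_one_le_zero)+
  then have "c = d" using nm unfolding mixed_def set_append by (metis (full_types) UnI1 UnI2)
  then have l: "length cs = 2" "length ds = 2"
    using assms(1,2) nz len c(2) d(2) unfolding second_order_semicircular_def
    by (cases c; auto)+
  have "cs = [c, c]" using c(1) unfolding l replicate_two .
  moreover have "ds = [d, d]" using d(1) unfolding l replicate_two .
  ultimately show ?thesis using \<open>c = d\<close> by blast
qed

lemma free_semicircular_NC_term_zero:
  assumes "second_order_semicircular \<phi> \<phi>2 a" "second_order_semicircular \<phi> \<phi>2 b"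
    and "second_order_free \<phi> \<phi>2 a b"
    and V: "V \<subseteq> {1..N}" "V \<noteq> {}"
    and nz: "free_cumulant \<phi> (increasing_entries (choose_args a b (map even [0..<N])) V) \<noteq> 0"
  shows "\<exists>c. map odd (sorted_list_of_set V) = [c, c]"
proof (rule free_semicircular_cumulant[OF assms(1-3)])
  have "finite V" using V(1) finite_subset by blast
  then show "free_cumulant \<phi> (choose_args a b (map odd (sorted_list_of_set V))) \<noteq> 0"
    "map odd (sorted_list_of_set V) \<noteq> []"
    using nz V entries_alternating[of "sorted_list_of_set V" N a b]
    by (auto simp: increasing_entries_def)
qed

text \<open>By the parity obstruction, every non-crossing partition has a block that is not a pair
  of equal labels, and the cumulant of that block vanishes.\<close>

lemma free_semicircular_moment_zero:
  assumes "second_order_semicircular \<phi> \<phi>2 a" "second_order_semicircular \<phi> \<phi>2 b"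
    and "second_order_free \<phi> \<phi>2 a b" and "n \<ge> 1"
  shows "\<phi> ((a * b) ^ n) = 0"
proof -
  let ?w = "choose_args a b (map even [0..<2 * n])"
  have len: "length ?w = 2 * n" by (simp add: choose_args_def)
  have "?w \<noteq> []" using len assms(4) by (metis list.size(3) mult_is_0 not_one_le_zero zero_neq_numeral)
  then have "\<phi> (prod_list ?w) = (\<Sum>P \<in> NC {1..2 * n}. \<Prod>V\<in>P. free_cumulant \<phi> (increasing_entries ?w V))"
    using moment_cumulant[of ?w \<phi>] by (simp add: len)
  also have "\<dots> = 0"
  proof (rule sum.neutral, rule ballI)
    fix P assume P: "P \<in> NC {1..2 * n}"
    then have "finite P"
      unfolding NC_def partition_on_def by (auto intro: finite_UnionD)
    obtain V where V: "V \<in> P" "\<forall>c. map odd (sorted_list_of_set V) \<noteq> [c, c]"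
      using NC_parity_pairing_impossible[of P 0 "2 * n"] P assms(4) by auto
    have "free_cumulant \<phi> (increasing_entries ?w V) = 0"
      using free_semicircular_NC_term_zero[OF assms(1-3), of V "2 * n"] V
        NC_block_subset[OF P V(1)] NC_block_nonempty[OF P V(1)] by metis
    then show "(\<Prod>V\<in>P. free_cumulant \<phi> (increasing_entries ?w V)) = 0"
      using \<open>finite P\<close> V(1) by (intro prod_zero) auto
  qed
  finally show ?thesis by (simp add: prod_list_alternating)
qed

section \<open>Cumulants of an element whose moments vanish\<close>

lemma entries_replicate:
  assumes "set is \<subseteq> {1..n}"
  shows "entries (replicate n x) is = replicate (length is) x"
proof -
  have "i - 1 < n" if "i \<in> set is" for i using assms that by fastforce
  then show ?thesis by (auto simp: entries_def intro!: map_replicate_const[symmetric] replicate_eqI)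
qed

lemma increasing_entries_replicate:
  assumes "V \<subseteq> {1..n}"
  shows "increasing_entries (replicate n x) V = replicate (card V) x"
  using assms finite_subset[OF assms] by (simp add: increasing_entries_def entries_replicate)

text \<open>In the recursion the moment vanishes, and every partition that is subtracted has only
  blocks of smaller positive size, whose cumulants vanish by induction.\<close>

lemma free_cumulant_of_moments_zero:
  assumes zero: "\<And>k. k \<ge> 1 \<Longrightarrow> \<phi> (x ^ k) = 0" and "n \<ge> 1"
  shows "free_cumulant_of \<phi> x n = 0"
  using assms(2)
proof (induction n rule: less_induct)
  case (less n)
  have "(\<Prod>V\<in>P. free_cumulant \<phi> (increasing_entries (replicate n x) V)) = 0"
    if P: "P \<in> NC {1..n} - {{{1..n}}}" for P
  proof -
    have part: "partition_on {1..n} P" using P by (simp add: NC_def)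
    have "finite P" using part by (auto simp: partition_on_def intro: finite_UnionD)
    \<comment> \<open>A block has to be exhibited, since an empty product would be 1.\<close>
    have "1 \<in> \<Union>P" using part less.prems by (auto simp: partition_on_def)
    then obtain V where V: "V \<in> P" by blast
    have sub: "V \<subseteq> {1..n}" "V \<noteq> {}" using P V NC_block_subset NC_block_nonempty by blast+
    have "card V < n" using NC_block_card_less[OF P V] by simp
    moreover have "card V \<ge> 1" using sub finite_subset[OF sub(1)] by (simp add: Suc_le_eq card_gt_0_iff)
    ultimately have "free_cumulant \<phi> (increasing_entries (replicate n x) V) = 0"
      using less.IH sub by (simp add: increasing_entries_replicate)
    then show ?thesis using \<open>finite P\<close> V by (intro prod_zero) auto
  qed
  then show ?case
    using zero[OF less.prems]
    by (subst free_cumulant.simps) (simp add: prod_list_replicate del: One_nat_def)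
qed

lemma least_power_pos: "permutation f \<Longrightarrow> least_power f x \<ge> 1"
  using least_power_of_permutation(2)[of f x] by simp

lemma support_subset:
  assumes "f permutes S" "x \<in> S"
  shows "set (support f x) \<subseteq> S"
  using permutes_in_image[OF permutes_funpow[OF assms(1)]] assms(2) by auto

lemma orbit_Min:
  assumes "f permutes S" "finite S" "V \<in> cycle_partition S f"
  shows "Min V \<in> S" "orbit f (Min V) = V"
proof -
  obtain x where x: "x \<in> S" "V = orbit f x" using assms(3) by (auto simp: cycle_partition_def)
  have "V \<subseteq> S" using permutes_orbit_subset[OF assms(1) x(1)] x(2) by simp
  moreover have "V \<noteq> {}" using x(2) orbit_nonempty by metis
  ultimately have "Min V \<in> V" using finite_subset[OF _ assms(2)] by (intro Min_in) auto
  then show "Min V \<in> S" using \<open>V \<subseteq> S\<close> by blast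
  show "orbit f (Min V) = V"
    using cyclic_on_orbit[OF assms(1,2)] \<open>Min V \<in> V\<close> unfolding x(2) by (rule orbit_cyclic_eq3)
qed

text \<open>Every term subtracted in the recursion contains a first order cumulant of
  \<open>x\<close>, which is zero. In \<open>S_NC\<close> all factors are such cumulants; in
  \<open>S_NC'\<close> an unmerged block supplies one, once the leading term is excluded.\<close>

lemma second_order_cumulant_of_moments_zero:
  assumes zero: "\<And>k. k \<ge> 1 \<Longrightarrow> \<phi> (x ^ k) = 0" and "n \<ge> 1" "m \<ge> 1"
  shows "second_order_cumulant_of \<phi> \<phi>2 x n m = \<phi>2 (x ^ n) (x ^ m)"
proof -
  have \<kappa>: "free_cumulant_of \<phi> x k = 0" if "k \<ge> 1" for k
    using free_cumulant_of_moments_zero[of \<phi> x k] zero that by blast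
  let ?w = "replicate n x @ replicate m x" and ?S = "{1..n + m}"
  have w: "?w = replicate (n + m) x" by (simp add: replicate_add)
  have S_NC: "(\<Sum>\<pi> \<in> S_NC n m. \<Prod>V \<in> cycle_partition ?S \<pi>. free_cumulant \<phi> (cycle_entries ?w \<pi> V)) = 0"
  proof (rule sum.neutral, rule ballI)
    fix \<pi> assume "\<pi> \<in> S_NC n m"
    then have \<pi>: "\<pi> permutes ?S" by (rule S_NC_permutes)
    then have perm: "permutation \<pi>" using permutation_permutes by blast
    have "1 \<in> ?S" using assms(2) by simp
    then have V: "orbit \<pi> 1 \<in> cycle_partition ?S \<pi>" by (simp add: cycle_partition_def)
    let ?s = "support \<pi> (Min (orbit \<pi> 1))"
    have "set ?s \<subseteq> ?S"
      using orbit_Min[OF \<pi> _ V] by (intro support_subset[OF \<pi>]) simp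
    then have "cycle_entries ?w \<pi> (orbit \<pi> 1) = replicate (length ?s) x"
      unfolding w cycle_entries_def by (rule entries_replicate)
    then have "free_cumulant \<phi> (cycle_entries ?w \<pi> (orbit \<pi> 1)) = 0"
      using \<kappa> least_power_pos[OF perm] by simp
    then show "(\<Prod>V \<in> cycle_partition ?S \<pi>. free_cumulant \<phi> (cycle_entries ?w \<pi> V)) = 0"
      using V by (intro prod_zero finite_cycle_partition) auto
  qed
  have S_NC': "(let A = merged_cycle {1..n} U P; B = merged_cycle {n + 1..n + m} U P in
        second_order_cumulant \<phi> \<phi>2 (increasing_entries ?w A) (increasing_entries ?w B)
        * (\<Prod>V \<in> P - {A, B}. free_cumulant \<phi> (increasing_entries ?w V))) = 0"
    if UP: "(U, P) \<in> S_NC' n m - {({?S}, {{1..n}, {n + 1..n + m}})}" for U P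
  proof -
    from UP have "(U, P) \<in> S_NC' n m" by blast
    then obtain P1 P2 A B where *: "P1 \<in> NC {1..n}" "P2 \<in> NC {n + 1..n + m}" "A \<in> P1" "B \<in> P2"
      "P = P1 \<union> P2" "U = insert (A \<union> B) (P - {A, B})"
      "merged_cycle {1..n} U P = A" "merged_cycle {n + 1..n + m} U P = B"
      by (rule S_NC'_memE)
    have part: "partition_on {1..n} P1" "partition_on {n + 1..n + m} P2"
      using *(1,2) by (simp_all add: NC_def)
    have fin: "finite P"
      using part unfolding *(5) by (auto simp: partition_on_def intro!: finite_UnionD)
    have disj: "P1 \<inter> P2 = {}"
    proof (rule ccontr)
      assume "P1 \<inter> P2 \<noteq> {}"
      then obtain V where "V \<in> P1" "V \<in> P2" by blast
      then have "V \<subseteq> {1..n} \<inter> {n + 1..n + m}" "V \<noteq> {}"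
        using NC_block_subset[OF *(1), of V] NC_block_subset[OF *(2), of V] NC_block_nonempty[OF *(1), of V]
        by blast+
      then show False by auto
    qed
    \<comment> \<open>Without an unmerged block each circle would be a single block, which is the
      excluded leading term.\<close>
    have "P - {A, B} \<noteq> {}"
    proof
      assume "P - {A, B} = {}"
      then have "P1 = {A}" "P2 = {B}" using *(3-5) disj by blast+
      then have AB: "A = {1..n}" "B = {n + 1..n + m}" using part by (auto simp: partition_on_def)
      moreover have "{1..n} \<union> {n + 1..n + m} = ?S" by auto
      moreover have "P = {A, B}" using *(5) \<open>P1 = {A}\<close> \<open>P2 = {B}\<close> by blast
      moreover have "U = {A \<union> B}" using *(6) \<open>P = {A, B}\<close> by blast
      ultimately show False using UP by simp
    qed
    then obtain V where V: "V \<in> P - {A, B}" by blast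
    have sub: "V \<subseteq> ?S" "V \<noteq> {}"
      using V *(5) NC_block_subset[OF *(1), of V] NC_block_subset[OF *(2), of V]
        NC_block_nonempty[OF *(1), of V] NC_block_nonempty[OF *(2), of V] by fastforce+
    then have "card V \<ge> 1" using finite_subset[OF sub(1)] by (simp add: Suc_le_eq card_gt_0_iff)
    then have "free_cumulant \<phi> (increasing_entries ?w V) = 0"
      using sub \<kappa> unfolding w by (simp add: increasing_entries_replicate)
    then have "(\<Prod>V \<in> P - {A, B}. free_cumulant \<phi> (increasing_entries ?w V)) = 0"
      using V fin by (intro prod_zero) auto
    then show ?thesis unfolding *(7,8) Let_def by simp
  qed
  have "(\<Sum>(U, P) \<in> S_NC' n m - {({?S}, {{1..n}, {n + 1..n + m}})}.
        let A = merged_cycle {1..n} U P; B = merged_cycle {n + 1..n + m} U P in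
        second_order_cumulant \<phi> \<phi>2 (increasing_entries ?w A) (increasing_entries ?w B)
        * (\<Prod>V \<in> P - {A, B}. free_cumulant \<phi> (increasing_entries ?w V))) = 0"
    using S_NC' by (intro sum.neutral ballI) (simp only: split: prod.split, blast)
  with S_NC show ?thesis
    unfolding second_order_cumulant.simps[of \<phi> \<phi>2 "replicate n x"] length_replicate prod_list_replicate Let_def
    by simp
qed

section \<open>The sum over \<open>S_NC\<close> for the alternating word\<close>

lemma support_of_length_two:
  assumes "permutation f" "length (support f x) = 2"
  shows "support f x = [x, f x]" "f x \<noteq> x" "f (f x) = x"
proof -
  have lp: "least_power f x = 2" using assms(2) by simp
  then show "support f x = [x, f x]" by (simp add: numeral_2_eq_2)
  show "f x \<noteq> x" using least_power_le[of 1 f x] lp by auto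
  show "f (f x) = x" using least_power_of_permutation(1)[OF assms(1), of x] lp by (simp add: numeral_2_eq_2)
qed

lemma cycle_entries_alternating:
  assumes "f permutes {1..N}" "V \<in> cycle_partition {1..N} f"
  shows "cycle_entries (choose_args a b (map even [0..<N])) f V =
    choose_args a b (map odd (support f (Min V)))"
  unfolding cycle_entries_def
  using orbit_Min(1)[OF assms(1) _ assms(2)] by (intro entries_alternating support_subset[OF assms(1)]) simp

text \<open>In a nonzero product every cycle has a label word \<open>[c, c]\<close>, so \<pi> is a
  pairing of positions of equal parity and the classification by reflections applies.\<close>

lemma free_semicircular_S_NC_nonzero:
  assumes "second_order_semicircular \<phi> \<phi>2 a" "second_order_semicircular \<phi> \<phi>2 b"
    and "second_order_free \<phi> \<phi>2 a b"
    and \<pi>: "\<pi> \<in> S_NC p q" and even: "even p" "even q" and pos: "p \<ge> 1" "q \<ge> 1"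
    and nz: "(\<Prod>V \<in> cycle_partition {1..p + q} \<pi>.
      free_cumulant \<phi> (cycle_entries (choose_args a b (map even [0..<p + q])) \<pi> V)) \<noteq> 0"
  shows "p = q" "\<exists>c\<in>{1..p}. odd c \<and> \<pi> = reflection p (int c)"
proof -
  let ?S = "{1..p + q}" and ?w = "choose_args a b (map even [0..<p + q])"
  have perm: "\<pi> permutes ?S" using \<pi> by (rule S_NC_permutes)
  then have permutation: "permutation \<pi>" using permutation_permutes by blast
  have block: "\<exists>x. V = {x, \<pi> x} \<and> \<pi> x \<noteq> x \<and> \<pi> (\<pi> x) = x \<and> odd x = odd (\<pi> x)"
    if V: "V \<in> cycle_partition ?S \<pi>" for V
  proof -
    let ?x = "Min V"
    have ne: "map odd (support \<pi> ?x) \<noteq> []" using least_power_pos[OF permutation, of ?x] by simp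
    have "free_cumulant \<phi> (cycle_entries ?w \<pi> V) \<noteq> 0"
      using nz V finite_cycle_partition[of ?S \<pi>] by (auto simp: prod_zero_iff)
    then have "free_cumulant \<phi> (choose_args a b (map odd (support \<pi> ?x))) \<noteq> 0"
      using cycle_entries_alternating[OF perm V, of a b] by simp
    from free_semicircular_cumulant[OF assms(1-3) ne this]
    obtain c where c: "map odd (support \<pi> ?x) = [c, c]" ..
    from arg_cong[OF this, of length] have "length (support \<pi> ?x) = 2" by simp
    note two = support_of_length_two[OF permutation this]
    have "odd ?x = odd (\<pi> ?x)" using c unfolding two(1) by simp
    moreover have "V = {?x, \<pi> ?x}"
      using orbit_Min(2)[OF perm _ V] orbit_involution[of \<pi> ?x, OF two(3)] by simp
    ultimately show ?thesis using two(2,3) by blast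
  qed
  have card: "card V = 2" if "V \<in> cycle_partition ?S \<pi>" for V
  proof -
    from block[OF that] obtain x where "V = {x, \<pi> x}" "\<pi> x \<noteq> x" by blast
    then show ?thesis by simp
  qed
  have parity: "odd (\<pi> i) \<longleftrightarrow> odd i" if "i \<in> ?S" for i
  proof -
    have "orbit \<pi> i \<in> cycle_partition ?S \<pi>" using that by (simp add: cycle_partition_def)
    from block[OF this] obtain x where x: "orbit \<pi> i = {x, \<pi> x}" "\<pi> (\<pi> x) = x" "odd x = odd (\<pi> x)"
      by blast
    have "i \<in> {x, \<pi> x}"
      using permutation_self_in_orbit[OF permutation, of i] x(1) by simp
    then show ?thesis using x(2,3) by auto
  qed
  show "p = q" "\<exists>c\<in>{1..p}. odd c \<and> \<pi> = reflection p (int c)"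
    using S_NC_pairing_reflection[OF \<pi> even pos parity card] by blast+
qed

text \<open>Each cycle is read from its smaller point \<open>i\<close>, on the first circle. Parity
  preservation gives its partner the same letter, so the cycle contributes the second cumulant of
  that letter.\<close>

lemma free_cumulants_reflection:
  assumes "even p" "odd c"
  shows "(\<Prod>V \<in> cycle_partition {1..p + p} (reflection p c).
      free_cumulant \<phi> (cycle_entries (choose_args a b (map even [0..<p + p])) (reflection p c) V)) =
    (\<Prod>i\<in>{1..p}. free_cumulant_of \<phi> (if odd i then a else b) 2)"
proof -
  let ?\<rho> = "reflection p c" and ?w = "choose_args a b (map even [0..<p + p])"
  have perm: "?\<rho> permutes {1..p + p}" by (rule reflection_permutes)
  have "free_cumulant \<phi> (cycle_entries ?w ?\<rho> {i, ?\<rho> i}) = free_cumulant_of \<phi> (if odd i then a else b) 2"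
    if i: "i \<in> {1..p}" for i
  proof -
    have \<rho>i: "?\<rho> i \<in> {p + 1..p + p}" using reflection_left[OF i] .
    have Min: "Min {i, ?\<rho> i} = i" using i \<rho>i by simp
    have "least_power ?\<rho> i \<le> 2"
      by (rule least_power_le) (simp_all add: numeral_2_eq_2 reflection_involution)
    moreover have "least_power ?\<rho> i > Suc 0"
      using perm i \<rho>i by (intro least_power_gt_one) (auto simp: permutation_permutes)
    ultimately have "least_power ?\<rho> i = 2" by simp
    then have supp: "support ?\<rho> i = [i, ?\<rho> i]" by (simp add: numeral_2_eq_2)
    have "odd (?\<rho> i) \<longleftrightarrow> odd i" using i by (intro reflection_parity assms) auto
    moreover have "{i, ?\<rho> i} \<in> cycle_partition {1..p + p} ?\<rho>"
      using i unfolding cycle_partition_reflection(1) by blast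
    ultimately have "cycle_entries ?w ?\<rho> {i, ?\<rho> i} = choose_args a b [odd i, odd i]"
      using cycle_entries_alternating[OF perm, of "{i, ?\<rho> i}" a b] unfolding Min supp by simp
    then show ?thesis by (simp add: choose_args_def numeral_2_eq_2)
  qed
  then show ?thesis
    unfolding cycle_partition_reflection(1)
    by (simp add: prod.reindex[OF cycle_partition_reflection(2)] del: One_nat_def)
qed

lemma prod_alternating:
  fixes x y :: "'a::comm_monoid_mult"
  shows "(\<Prod>i\<in>{1..2 * n}. if odd i then x else y) = (x * y) ^ n"
  by (induction n) (simp_all add: mult_ac)

text \<open>The image \<open>p + c\<close> of \<open>1\<close> recovers \<open>c\<close>. The range
  of \<open>c\<close> matters, since the reflection depends on \<open>c\<close> only modulo
  \<open>p\<close>.\<close>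

lemma inj_on_reflection: "inj_on (\<lambda>c. reflection p (int c)) {1..p}"
proof (rule inj_onI)
  fix c d assume cd: "c \<in> {1..p}" "d \<in> {1..p}" "reflection p (int c) = reflection p (int d)"
  have "reflection p (int e) 1 = p + e" if "e \<in> {1..p}" for e
    using that by (intro reflection_eqI) auto
  from this[OF cd(1)] this[OF cd(2)] cd(3) show "c = d" by simp
qed

text \<open>The number of odd parameters is the source of the factor \<open>n\<close> in the
  formula.\<close>

lemma card_odd_interval: "card {c \<in> {1..2 * n}. odd c} = n"
proof -
  have "{c \<in> {1..2 * n}. odd c} = (\<lambda>k. 2 * k + 1) ` {..<n}"
    by (auto elim!: oddE)
  then show ?thesis by (simp add: card_image inj_on_def)
qed

lemma finite_S_NC: "finite (S_NC p q)"
  by (rule finite_subset[OF _ finite_permutations[of "{1..p + q}"]]) (auto simp: S_NC_def)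

text \<open>Only the reflections with odd parameter survive, and all of them contribute the same
  product.\<close>

lemma free_semicircular_S_NC_sum:
  assumes "second_order_semicircular \<phi> \<phi>2 a" "second_order_semicircular \<phi> \<phi>2 b"
    and "second_order_free \<phi> \<phi>2 a b" and "n \<ge> 1" "m \<ge> 1"
  shows "(\<Sum>\<pi> \<in> S_NC (2 * n) (2 * m). \<Prod>V \<in> cycle_partition {1..2 * n + 2 * m} \<pi>.
      free_cumulant \<phi> (cycle_entries (choose_args a b (map even [0..<2 * n + 2 * m])) \<pi> V)) =
    (if n = m then of_nat n * (free_cumulant_of \<phi> a 2 * free_cumulant_of \<phi> b 2) ^ n else 0)"
    (is "sum ?f _ = _")
proof (cases "n = m")
  case False
  have "?f \<pi> = 0" if "\<pi> \<in> S_NC (2 * n) (2 * m)" for \<pi>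
    using free_semicircular_S_NC_nonzero(1)[OF assms(1-3) that] assms(4,5) False by force
  then have "sum ?f (S_NC (2 * n) (2 * m)) = 0" by (intro sum.neutral) blast
  then show ?thesis using False by simp
next
  case True
  let ?p = "2 * n" and ?C = "{c \<in> {1..2 * n}. odd c}" and ?\<rho> = "\<lambda>c. reflection (2 * n) (int c)"
  have p: "?p \<ge> 1" using assms(4) by simp
  have "sum ?f (S_NC ?p (2 * m)) = sum ?f (?\<rho> ` ?C)"
  proof (rule sum.mono_neutral_right[OF finite_S_NC])
    show "?\<rho> ` ?C \<subseteq> S_NC ?p (2 * m)" using reflection_in_S_NC[OF p] True by blast
    show "\<forall>\<pi>\<in>S_NC ?p (2 * m) - ?\<rho> ` ?C. ?f \<pi> = 0"
      using free_semicircular_S_NC_nonzero(2)[OF assms(1-3)] p assms(5) by fastforce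
  qed
  also have "\<dots> = (\<Sum>c\<in>?C. ?f (?\<rho> c))"
    by (subst sum.reindex[OF inj_on_subset[OF inj_on_reflection]]) auto
  also have "\<dots> = (\<Sum>c\<in>?C. (free_cumulant_of \<phi> a 2 * free_cumulant_of \<phi> b 2) ^ n)"
  proof (rule sum.cong[OF refl])
    fix c assume "c \<in> ?C"
    then have "?f (?\<rho> c) = (\<Prod>i\<in>{1..?p}. free_cumulant_of \<phi> (if odd i then a else b) 2)"
      using free_cumulants_reflection[of ?p "int c" \<phi> a b] True by simp
    also have "\<dots> = (\<Prod>i\<in>{1..?p}. if odd i then free_cumulant_of \<phi> a 2 else free_cumulant_of \<phi> b 2)"
      by (intro prod.cong) auto
    finally show "?f (?\<rho> c) = (free_cumulant_of \<phi> a 2 * free_cumulant_of \<phi> b 2) ^ n"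
      unfolding prod_alternating .
  qed
  finally show ?thesis using True unfolding sum_constant card_odd_interval by simp
qed

section \<open>Second order moments and cumulants of the product\<close>

text \<open>The \<open>S_NC\<close> part of the moment-cumulant formula is already computed. The
  \<open>S_NC'\<close> part vanishes because a nonzero term would turn all blocks of the first
  circle, the merged one included, into pairs of equal parity.\<close>

lemma free_semicircular_second_order_moment:
  assumes "second_order_semicircular \<phi> \<phi>2 a" "second_order_semicircular \<phi> \<phi>2 b"
    and "second_order_free \<phi> \<phi>2 a b" and "n \<ge> 1" "m \<ge> 1"
  shows "\<phi>2 ((a * b) ^ n) ((a * b) ^ m) =
    (if n = m then of_nat n * (free_cumulant_of \<phi> a 2 * free_cumulant_of \<phi> b 2) ^ n else 0)"
proof -
  let ?xs = "choose_args a b (map even [0..<2 * n])" and ?ys = "choose_args a b (map even [0..<2 * m])"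
  let ?w = "choose_args a b (map even [0..<2 * n + 2 * m])"
  have len: "length ?xs = 2 * n" "length ?ys = 2 * m" by (simp_all add: choose_args_def)
  then have ne: "?xs \<noteq> []" "?ys \<noteq> []"
    using assms(4,5) by (metis list.size(3) mult_is_0 not_one_le_zero zero_neq_numeral)+
  have S_NC': "(let A = merged_cycle {1..2 * n} U P; B = merged_cycle {2 * n + 1..2 * n + 2 * m} U P in
        second_order_cumulant \<phi> \<phi>2 (increasing_entries ?w A) (increasing_entries ?w B)
        * (\<Prod>V \<in> P - {A, B}. free_cumulant \<phi> (increasing_entries ?w V))) = 0"
    if UP: "(U, P) \<in> S_NC' (2 * n) (2 * m)" for U P
  proof (rule ccontr)
    obtain P1 P2 A B where *: "P1 \<in> NC {1..2 * n}" "P2 \<in> NC {2 * n + 1..2 * n + 2 * m}"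
      "A \<in> P1" "B \<in> P2" "P = P1 \<union> P2" "U = insert (A \<union> B) (P - {A, B})"
      "merged_cycle {1..2 * n} U P = A" "merged_cycle {2 * n + 1..2 * n + 2 * m} U P = B"
      using UP by (rule S_NC'_memE)
    have sub: "V \<subseteq> {1..2 * n + 2 * m}" "V \<noteq> {}" "finite V" if "V \<in> P" for V
    proof -
      show "V \<subseteq> {1..2 * n + 2 * m}" "V \<noteq> {}"
        using that *(5) NC_block_subset[OF *(1), of V] NC_block_subset[OF *(2), of V]
          NC_block_nonempty[OF *(1), of V] NC_block_nonempty[OF *(2), of V] by fastforce+
      then show "finite V" using finite_subset by blast
    qed
    have fin: "finite P"
      using *(1,2) unfolding *(5) NC_def by (auto simp: partition_on_def intro!: finite_UnionD)
    assume "\<not> ?thesis"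
    then have nz: "second_order_cumulant \<phi> \<phi>2 (increasing_entries ?w A) (increasing_entries ?w B) \<noteq> 0"
      "(\<Prod>V \<in> P - {A, B}. free_cumulant \<phi> (increasing_entries ?w V)) \<noteq> 0"
      unfolding *(7,8) Let_def by simp_all
    have AB: "A \<in> P" "B \<in> P" using *(3-5) by simp_all
    have ent: "increasing_entries ?w V = choose_args a b (map odd (sorted_list_of_set V))"
      "map odd (sorted_list_of_set V) \<noteq> []" if "V \<in> P" for V
      using entries_alternating[of "sorted_list_of_set V" "2 * n + 2 * m" a b] sub[OF that]
      by (auto simp: increasing_entries_def)
    \<comment> \<open>The merged cycle enters through a second order cumulant; its nonvanishing also
      forces a pair of equal labels on each side.\<close>
    obtain c where "map odd (sorted_list_of_set A) = [c, c]"
      using free_semicircular_second_order_cumulant[OF assms(1-3) ent(2)[OF AB(1)] ent(2)[OF AB(2)]]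
        nz(1) unfolding ent(1)[OF AB(1)] ent(1)[OF AB(2)] by metis
    moreover have "\<exists>c. map odd (sorted_list_of_set V) = [c, c]" if "V \<in> P - {A, B}" for V
    proof (rule free_semicircular_NC_term_zero[OF assms(1-3)])
      show "V \<subseteq> {1..2 * n + 2 * m}" "V \<noteq> {}" using sub that by blast+
      show "free_cumulant \<phi> (increasing_entries ?w V) \<noteq> 0"
        using nz(2) that fin by (auto simp: prod_zero_iff)
    qed
    \<comment> \<open>Hence every block of \<open>P1\<close> other than \<open>A\<close> is unmerged
      and carries a first order cumulant.\<close>
    moreover have "B \<notin> P1"
    proof
      assume "B \<in> P1"
      then have "B \<subseteq> {1..2 * n} \<inter> {2 * n + 1..2 * n + 2 * m}"
        using NC_block_subset[OF *(1)] NC_block_subset[OF *(2,4)] by blast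
      then show False using sub(2)[OF AB(2)] by auto
    qed
    ultimately have "\<exists>c. map odd (sorted_list_of_set V) = [c, c]" if "V \<in> P1" for V
      using that *(5) by (cases "V = A") auto
    moreover have "\<exists>V\<in>P1. \<forall>c. map odd (sorted_list_of_set V) \<noteq> [c, c]"
      by (rule NC_parity_pairing_impossible[of _ 0 "2 * n"]) (use *(1) assms(4) in simp_all)
    ultimately show False by metis
  qed
  have "(\<Sum>(U, P) \<in> S_NC' (2 * n) (2 * m).
      let A = merged_cycle {1..2 * n} U P; B = merged_cycle {2 * n + 1..2 * n + 2 * m} U P in
        second_order_cumulant \<phi> \<phi>2 (increasing_entries ?w A) (increasing_entries ?w B)
        * (\<Prod>V \<in> P - {A, B}. free_cumulant \<phi> (increasing_entries ?w V))) = 0"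
    using S_NC' by (intro sum.neutral ballI) (simp only: split: prod.split, blast)
  then show ?thesis
    using second_order_moment_cumulant[OF ne, of \<phi>2 \<phi>] free_semicircular_S_NC_sum[OF assms]
    unfolding len alternating_append prod_list_alternating by simp
qed

theorem proposition1p11:
  fixes scale :: "complex \<Rightarrow> 'a::ring_1 \<Rightarrow> 'a"
    and \<phi> :: "'a \<Rightarrow> complex" and \<phi>2 :: "'a \<Rightarrow> 'a \<Rightarrow> complex"
    and a b :: 'a and n m :: nat
  assumes "second_order_ncps scale \<phi> \<phi>2"
    and "second_order_semicircular \<phi> \<phi>2 a"
    and "second_order_semicircular \<phi> \<phi>2 b"
    and "second_order_free \<phi> \<phi>2 a b"
    and "n \<ge> 1" and "m \<ge> 1"
  shows "second_order_cumulant_of \<phi> \<phi>2 (a * b) n m =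
    (if n = m then of_nat n * (free_cumulant_of \<phi> a 2 * free_cumulant_of \<phi> b 2) ^ n else 0)"
proof -
  \<comment> \<open>All moments of \<open>a * b\<close> vanish, so the recursion has no correction
    terms.\<close>
  have "second_order_cumulant_of \<phi> \<phi>2 (a * b) n m = \<phi>2 ((a * b) ^ n) ((a * b) ^ m)"
    using free_semicircular_moment_zero[OF assms(2-4)]
    by (rule second_order_cumulant_of_moments_zero) (use assms(5,6) in auto)
  then show ?thesis
    by (simp only: free_semicircular_second_order_moment[OF assms(2-6)])
qed

end
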